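(* Let $F\subset\mathbb{P}^2_{\mathbb{C}}$ be the Fermat cubic $x^3+y^3+z^3=0$. For any sextactic point $S\in F$, the residual intersection point of $F$ with the line tangent to $F$ at $S$ is one of the flex points of $F$.
   Context: A point $P$ of a smooth plane curve $C$ of degree at least $3$ is called sextactic if there exists an irreducible conic $D$ whose intersection multiplicity with $C$ at $P$ is at least $6$. A flex point of $C$ is a point at which the tangent line meets $C$ with multiplicity strictly bigger than $2$. If $P\in F$ is not a flex, the tangent line to $F$ at $P$ meets $F$ at $P$ with multiplicity $2$ and at exactly one further point, called the residual intersection point. Sextactic points of $F$ are not flexes. *)

theory Defs
  imports
    "HOL-Analysis.Analysis"
    "HOL-Computational_Algebra.Computational_Algebra"
    "HOL-Library.Extended_Nat"
begin

unbundle no fps_syntax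
unbundle vec_syntax

section \<open>The complex projective plane\<close>

definition proj_rel :: "complex^3 \<Rightarrow> complex^3 \<Rightarrow> bool" where
  "proj_rel v w \<longleftrightarrow> v \<noteq> 0 \<and> w \<noteq> 0 \<and> (\<exists>c. c \<noteq> 0 \<and> w = c *s v)"

quotient_type proj_plane = "complex^3" / partial: proj_rel
  morphisms hcoords proj_point
proof (rule part_equivpI)
  have "(1 :: complex^3) \<noteq> 0"
    by (simp add: vec_eq_iff)
  then have "proj_rel 1 1"
    by (auto simp: proj_rel_def intro: exI[of _ 1])
  then show "\<exists>v. proj_rel v v" ..
  show "symp proj_rel"
  proof (rule sympI)
    fix v w assume "proj_rel v w"
    then obtain c where c: "v \<noteq> 0" "w \<noteq> 0" "c \<noteq> 0" "w = c *s v"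
      by (auto simp: proj_rel_def)
    then have "v = inverse c *s w"
      by (simp add: vec_eq_iff)
    with c show "proj_rel w v"
      unfolding proj_rel_def by (metis inverse_nonzero_iff_nonzero)
  qed
  show "transp proj_rel"
  proof (rule transpI)
    fix u v w assume "proj_rel u v" "proj_rel v w"
    then obtain c d where c: "u \<noteq> 0" "w \<noteq> 0" "c \<noteq> 0" "d \<noteq> 0" "v = c *s u" "w = d *s v"
      by (auto simp: proj_rel_def)
    then have "w = (d * c) *s u" "d * c \<noteq> 0"
      by (simp_all add: vec_eq_iff)
    with c show "proj_rel u w"
      unfolding proj_rel_def by blast
  qed
qed

section \<open>Ternary forms\<close>

text \<open>Polynomials in \<open>x, y, z\<close>, with \<open>x\<close> the outermost and \<open>z\<close> the innermost variable.\<close>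

type_synonym poly3 = "complex poly poly poly"

definition const3 :: "complex \<Rightarrow> poly3" where
  "const3 c = [:[:[:c:]:]:]"

definition varX :: poly3 where "varX = [:0, 1:]"
definition varY :: poly3 where "varY = [:[:0, 1:]:]"
definition varZ :: poly3 where "varZ = [:[:[:0, 1:]:]:]"

definition eval3 :: "poly3 \<Rightarrow> complex^3 \<Rightarrow> complex" where
  "eval3 F v = poly (poly (poly F [:[:v $ 1:]:]) [:v $ 2:]) (v $ 3)"

definition partialX :: "poly3 \<Rightarrow> poly3" where "partialX F = pderiv F"
definition partialY :: "poly3 \<Rightarrow> poly3" where "partialY F = map_poly pderiv F"
definition partialZ :: "poly3 \<Rightarrow> poly3" where "partialZ F = map_poly (map_poly pderiv) F"

text \<open>Homogeneous of degree \<open>d\<close>; the zero polynomial is a form of every degree.\<close>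

definition form :: "nat \<Rightarrow> poly3 \<Rightarrow> bool" where
  "form d F \<longleftrightarrow> (\<forall>i j k. coeff (coeff (coeff F i) j) k \<noteq> 0 \<longrightarrow> i + j + k = d)"

text \<open>Plane curves are given by forms. Vanishing of a form at a point does not depend on the
  representative chosen by \<open>hcoords\<close>.\<close>

definition on_curve :: "poly3 \<Rightarrow> proj_plane \<Rightarrow> bool" where
  "on_curve F P \<longleftrightarrow> eval3 F (hcoords P) = 0"

definition smooth_plane_curve :: "nat \<Rightarrow> poly3 \<Rightarrow> bool" where
  "smooth_plane_curve d F \<longleftrightarrow> d \<ge> 1 \<and> F \<noteq> 0 \<and> form d F \<and>
     (\<forall>P. on_curve F P \<longrightarrow>
        \<not> (on_curve (partialX F) P \<and> on_curve (partialY F) P \<and> on_curve (partialZ F) P))"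

text \<open>The linear form defining the tangent line to \<open>F\<close> at a smooth point \<open>P\<close>. Changing the
  representative of \<open>P\<close> rescales it by a nonzero constant.\<close>

definition tangent_line :: "poly3 \<Rightarrow> proj_plane \<Rightarrow> poly3" where
  "tangent_line F P =
     const3 (eval3 (partialX F) (hcoords P)) * varX +
     const3 (eval3 (partialY F) (hcoords P)) * varY +
     const3 (eval3 (partialZ F) (hcoords P)) * varZ"

section \<open>Intersection multiplicity\<close>

text \<open>The local ring of the projective plane at \<open>P\<close>, inside the field of fractions of
  \<open>\<complex>[x, y, z]\<close>: quotients of forms of equal degree whose denominator does not vanish at \<open>P\<close>.\<close>

definition local_ring :: "proj_plane \<Rightarrow> poly3 fract set" where
  "local_ring P = {Fract A B | A B. (\<exists>d. form d A \<and> form d B) \<and> \<not> on_curve B P}"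

text \<open>Local equations of \<open>F\<close> at \<open>P\<close>: dividing \<open>F\<close> by a form of the same degree not vanishing at
  \<open>P\<close>. Any two of them differ by a unit of the local ring.\<close>

definition local_equations :: "poly3 \<Rightarrow> proj_plane \<Rightarrow> poly3 fract set" where
  "local_equations F P = {Fract F U | U. (\<exists>d. form d F \<and> form d U) \<and> \<not> on_curve U P}"

definition local_ideal :: "poly3 \<Rightarrow> poly3 \<Rightarrow> proj_plane \<Rightarrow> poly3 fract set" where
  "local_ideal F G P = {a * f + b * g | a b f g.
     a \<in> local_ring P \<and> b \<in> local_ring P \<and>
     f \<in> local_equations F P \<and> g \<in> local_equations G P}"

definition lin_indep_mod :: "poly3 fract set \<Rightarrow> poly3 fract set \<Rightarrow> bool" where
  "lin_indep_mod I B \<longleftrightarrow>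
     (\<forall>c :: poly3 fract \<Rightarrow> complex.
        (\<Sum>b\<in>B. Fract (const3 (c b)) 1 * b) \<in> I \<longrightarrow> (\<forall>b\<in>B. c b = 0))"

text \<open>The dimension over \<open>\<complex>\<close> of the local ring modulo the ideal generated by local equations of
  \<open>F\<close> and \<open>G\<close>, with value \<open>\<infinity>\<close> if the quotient is not finite-dimensional.\<close>

definition intersection_mult :: "poly3 \<Rightarrow> poly3 \<Rightarrow> proj_plane \<Rightarrow> enat" where
  "intersection_mult F G P =
     Sup {enat (card B) | B. finite B \<and> B \<subseteq> local_ring P \<and> lin_indep_mod (local_ideal F G P) B}"

section \<open>Flexes, sextactic points and residual intersection points\<close>

definition flex :: "poly3 \<Rightarrow> proj_plane \<Rightarrow> bool" where
  "flex C P \<longleftrightarrow> (\<exists>d\<ge>3. smooth_plane_curve d C) \<and> on_curve C P \<and>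
     intersection_mult C (tangent_line C P) P > 2"

definition sextactic :: "poly3 \<Rightarrow> proj_plane \<Rightarrow> bool" where
  "sextactic C P \<longleftrightarrow> (\<exists>d\<ge>3. smooth_plane_curve d C) \<and> on_curve C P \<and>
     (\<exists>D. form 2 D \<and> irreducible D \<and> intersection_mult C D P \<ge> 6)"

text \<open>Meaningful for a point \<open>P\<close> of a smooth cubic \<open>C\<close> that is not a flex: only then is there
  exactly one further point of \<open>C\<close> on the tangent line at \<open>P\<close>.\<close>

definition residual_point :: "poly3 \<Rightarrow> proj_plane \<Rightarrow> proj_plane" where
  "residual_point C P = (THE R. R \<noteq> P \<and> on_curve C R \<and> on_curve (tangent_line C P) R)"

definition fermat_cubic :: poly3 where
  "fermat_cubic = varX ^ 3 + varY ^ 3 + varZ ^ 3"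

end

theory Submission
  imports Defs
begin

text \<open>
  The statement holds for every smooth plane cubic \<open>C\<close>. In terms of divisors, a conic \<open>D\<close> with
  contact of order \<open>6\<close> at \<open>S\<close> has \<open>div D = 6S\<close> on \<open>C\<close>, and the tangent line \<open>T\<close> at \<open>S\<close> has
  \<open>div T = 2S + R\<close>. Hence \<open>3R = div T\<^sup>3 - div D\<close> is linearly equivalent to a line
  section of \<open>C\<close>. Since lines cut out a complete linear system on \<open>C\<close>, some line meets \<open>C\<close> three times
  at \<open>R\<close>. The proof carries this argument out on coefficients.

  Take linear forms \<open>N, L, T\<close> with \<open>T\<close> the tangent at \<open>S\<close>, \<open>L(S) = 0\<close> and \<open>N(S) = 1\<close>. On the line
  \<open>T = 0\<close> the cubic has at least a double zero at \<open>S\<close>, so \<open>C = L\<^sup>2(\<alpha>N + \<beta>L) + TQ\<close> with \<open>Q(S) \<noteq> 0\<close>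
  (\<open>cubic_tangent_normal_form\<close>). If \<open>\<alpha> = 0\<close>, then \<open>T\<close> vanishes to order at least \<open>3\<close> along \<open>C\<close> at
  \<open>S\<close>, and a conic of contact order at least \<open>3\<close> contains the line \<open>T\<close>
  (\<open>flex_tangent_dvd_conic\<close>), so it is reducible. Otherwise \<open>N\<close> can be chosen with
  \<open>C = \<kappa>L\<^sup>2N + TQ\<close>, and \<open>R\<close> is the point \<open>T = N = 0\<close> (\<open>residual_point_eqI\<close>). Modulo \<open>C\<close> one may
  replace \<open>\<kappa>L\<^sup>2N\<close> by \<open>-TQ\<close>. Expanding an irreducible conic of contact order \<open>6\<close> in this way, two orders at a
  time, leaves a single relation \<open>q1 q3 = \<kappa> q4\<close> between coefficients of \<open>Q\<close> (\<open>conic_contact_6\<close>). The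
  same relation says exactly that \<open>C\<close> restricted to its tangent at \<open>R\<close> is a multiple of \<open>T\<^sup>3\<close>
  (\<open>flex_of_normal_form\<close>).

  Intersection multiplicities enter through the ideals \<open>contact_ideal F l p k\<close>, which contain the
  polynomials of order at least \<open>k\<close> along \<open>F\<close> at \<open>p\<close>. The local ring of a smooth point modulo the
  curve is a discrete valuation ring, which turns a lower bound for the multiplicity into membership
  in a contact ideal (\<open>contact_of_intersection_mult\<close>); conversely, membership of the curve in the
  contact ideal of a line bounds the multiplicity from below (\<open>intersection_mult_ge\<close>).
\<close>

(* The infix $ is reserved for the components of a vector. *)
no_notation fps_nth (infixl "$" 75)

section \<open>Evaluation and linear forms\<close>

lemma eval3_add [simp]: "eval3 (A + B) v = eval3 A v + eval3 B v"
  and eval3_diff [simp]: "eval3 (A - B) v = eval3 A v - eval3 B v"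
  and eval3_uminus [simp]: "eval3 (- A) v = - eval3 A v"
  and eval3_mult [simp]: "eval3 (A * B) v = eval3 A v * eval3 B v"
  and eval3_power [simp]: "eval3 (A ^ k) v = eval3 A v ^ k"
  and eval3_0 [simp]: "eval3 0 v = 0"
  and eval3_1 [simp]: "eval3 1 v = 1"
  and eval3_const3 [simp]: "eval3 (const3 c) v = c"
  and eval3_varX [simp]: "eval3 varX v = v $ 1"
  and eval3_varY [simp]: "eval3 varY v = v $ 2"
  and eval3_varZ [simp]: "eval3 varZ v = v $ 3"
  by (simp_all add: eval3_def const3_def varX_def varY_def varZ_def)

lemma const3_0 [simp]: "const3 0 = 0"
  and const3_1 [simp]: "const3 1 = 1"
  and const3_add: "const3 (a + b) = const3 a + const3 b"
  and const3_diff: "const3 (a - b) = const3 a - const3 b"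
  and const3_uminus: "const3 (- a) = - const3 a"
  and const3_mult: "const3 (a * b) = const3 a * const3 b"
  and const3_eq_0_iff [simp]: "const3 a = 0 \<longleftrightarrow> a = 0"
  by (simp_all add: const3_def one_pCons)

text \<open>Linear forms are represented by covectors, and evaluation of a linear form is the complex bilinear
  (not Hermitian) pairing.\<close>

definition pairing :: "complex^3 \<Rightarrow> complex^3 \<Rightarrow> complex" where
  "pairing w v = w $ 1 * v $ 1 + w $ 2 * v $ 2 + w $ 3 * v $ 3"

lemma pairing_add_left [simp]: "pairing (w + w') v = pairing w v + pairing w' v"
  and pairing_scale_left [simp]: "pairing (c *s w) v = c * pairing w v"
  and pairing_add_right [simp]: "pairing w (v + v') = pairing w v + pairing w v'"
  and pairing_diff_right [simp]: "pairing w (v - v') = pairing w v - pairing w v'"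
  and pairing_scale_right [simp]: "pairing w (c *s v) = c * pairing w v"
  and pairing_0_left [simp]: "pairing 0 v = 0"
  and pairing_0_right [simp]: "pairing w 0 = 0"
  by (simp_all add: pairing_def algebra_simps)

definition linear_form :: "complex^3 \<Rightarrow> poly3" where
  "linear_form w = const3 (w $ 1) * varX + const3 (w $ 2) * varY + const3 (w $ 3) * varZ"

lemma eval3_linear_form [simp]: "eval3 (linear_form w) v = pairing w v"
  by (simp add: linear_form_def pairing_def)

lemma linear_form_add: "linear_form (w + w') = linear_form w + linear_form w'"
  and linear_form_scale: "linear_form (c *s w) = const3 c * linear_form w"
  by (simp_all add: linear_form_def const3_add const3_mult algebra_simps)

lemma linear_form_axis:
  "linear_form (axis 1 1) = varX" "linear_form (axis 2 1) = varY" "linear_form (axis 3 1) = varZ"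
  by (simp_all add: linear_form_def axis_def)

lemma prime_elem_monic_linear: "prime_elem [:c, 1:]" for c :: "'a :: idom"
proof (rule prime_elemI)
  show "[:c, 1:] dvd a \<or> [:c, 1:] dvd b" if "[:c, 1:] dvd a * b" for a b
    using that by (simp add: poly_eq_0_iff_dvd[of _ "- c", simplified, symmetric])
qed (auto simp: is_unit_poly_iff)

text \<open>A linear form is, up to a unit, monic of degree one in one of the variables, with
  coefficients in the later variables only. Divisibility by such a polynomial is the vanishing at a
  root, so it is prime.\<close>

lemma linear_form_prime:
  assumes "l \<noteq> 0"
  shows "prime_elem (linear_form l)"
proof -
  have root: "prime_elem [:c, 1:]" for c :: "complex poly poly"
    by (rule prime_elem_monic_linear)
  have root': "prime_elem [:c, 1:]" for c :: "complex poly"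
    by (rule prime_elem_monic_linear)
  have root'': "prime_elem [:c, 1:]" for c :: complex
    by (rule prime_elem_monic_linear)
  have scaled: "prime_elem (u * f)" if "prime_elem f" "is_unit u" for u f :: poly3
    using that by (simp add: prime_elem_mult_unit_left)
  have unit: "is_unit (const3 c)" if "c \<noteq> 0" for c
    using that by (metis const3_1 const3_mult dvdI field_class.field_inverse mult.commute)
  have split_off: "linear_form l = const3 c * linear_form (inverse c *s l)" if "c \<noteq> 0" for c
    using that by (simp flip: linear_form_scale)
  consider "l $ 1 \<noteq> 0" | "l $ 1 = 0" "l $ 2 \<noteq> 0" | "l $ 1 = 0" "l $ 2 = 0" "l $ 3 \<noteq> 0"
    using assms by (auto simp: vec_eq_iff forall_3)
  then show ?thesis
  proof cases
    case 1
    then have "linear_form (inverse (l $ 1) *s l) = [:[:[:0, l $ 3 / l $ 1:], [:l $ 2 / l $ 1:]:], 1:]"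
      by (simp add: linear_form_def const3_def varX_def varY_def varZ_def field_simps one_pCons)
    then show ?thesis
      unfolding split_off[OF 1] by (simp only: prime_elem_const_poly_iff root scaled unit[OF 1])
  next
    case 2
    then have "linear_form (inverse (l $ 2) *s l) = [:[:[:0, l $ 3 / l $ 2:], 1:]:]"
      by (simp add: linear_form_def const3_def varX_def varY_def varZ_def field_simps one_pCons)
    then show ?thesis
      unfolding split_off[OF 2(2)] by (simp only: prime_elem_const_poly_iff root' scaled unit[OF 2(2)])
  next
    case 3
    then have "linear_form (inverse (l $ 3) *s l) = [:[:[:0, 1:]:]:]"
      by (simp add: linear_form_def const3_def varX_def varY_def varZ_def field_simps one_pCons)
    then show ?thesis
      unfolding split_off[OF 3(3)] by (simp only: prime_elem_const_poly_iff root'' scaled unit[OF 3(3)])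
  qed
qed

section \<open>Forms\<close>

lemma form_0 [simp]: "form d 0"
  by (simp add: form_def)

lemma form_add: "form d A \<Longrightarrow> form d B \<Longrightarrow> form d (A + B)"
  by (simp add: form_def) (metis add.right_neutral)

lemma form_mult:
  assumes "form d A" "form e B"
  shows "form (d + e) (A * B)"
  unfolding form_def
proof (intro allI impI)
  fix i j k
  assume "coeff (coeff (coeff (A * B) i) j) k \<noteq> 0"
  then have "(\<Sum>i'\<le>i. \<Sum>j'\<le>j. \<Sum>k'\<le>k. coeff (coeff (coeff A i') j') k' *
      coeff (coeff (coeff B (i - i')) (j - j')) (k - k')) \<noteq> 0"
    by (simp add: coeff_mult coeff_sum)
  then obtain i' j' k' where le: "i' \<le> i" "j' \<le> j" "k' \<le> k"
    and nz: "coeff (coeff (coeff A i') j') k' * coeff (coeff (coeff B (i - i')) (j - j')) (k - k') \<noteq> 0"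
    by (smt (verit) atMost_iff sum.not_neutral_contains_not_neutral)
  have "i' + j' + k' = d" "(i - i') + (j - j') + (k - k') = e"
    using assms nz by (auto simp: form_def)
  with le show "i + j + k = d + e"
    by simp
qed

lemma form_const3: "form 0 (const3 c)"
  by (auto simp: form_def const3_def coeff_pCons split: nat.splits)

lemma form_scale: "form d A \<Longrightarrow> form d (const3 c * A)"
  using form_mult[OF form_const3] by simp

lemma form_diff: "form d A \<Longrightarrow> form d B \<Longrightarrow> form d (A - B)"
  using form_add[of d A "const3 (-1) * B"] form_scale[of d B "-1"] by (simp add: const3_uminus)

lemma form_power: "form d A \<Longrightarrow> form (k * d) (A ^ k)"
  by (induction k) (use form_const3[of 1] in \<open>auto dest: form_mult\<close>)

lemma form_vars: "form 1 varX" "form 1 varY" "form 1 varZ"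
  by (auto simp: form_def varX_def varY_def varZ_def coeff_pCons split: nat.splits if_splits)

lemma form_linear_form: "form 1 (linear_form w)"
  unfolding linear_form_def by (intro form_add form_scale form_vars)

lemma form_linear_form_power: "form k (linear_form w ^ k)"
  using form_power[OF form_linear_form] by simp

lemma form_degree_unique:
  assumes "form d A" "form e A" "A \<noteq> 0"
  shows "d = e"
  using assms by (auto simp: form_def poly_eq_iff)

lemma form_0D:
  assumes "form 0 A"
  obtains c where "A = const3 c"
proof
  show "A = const3 (coeff (coeff (coeff A 0) 0) 0)"
    using assms by (fastforce simp: form_def const3_def poly_eq_iff coeff_pCons split: nat.splits)
qed

text \<open>Split off from a form the part divisible by \<open>x\<close>, from the rest the part divisible by \<open>y\<close>, and so
  on. What remains is a constant, hence zero in positive degree.\<close>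

lemma form_Suc_split_vars:
  assumes "form (Suc d) A"
  obtains A1 A2 A3 where "form d A1" "form d A2" "form d A3" "A = varX * A1 + varY * A2 + varZ * A3"
proof -
  obtain a A1 where A: "A = pCons a A1" by (cases A)
  obtain b A2 where a: "a = pCons b A2" by (cases a)
  obtain c A3 where b: "b = pCons c A3" by (cases b)
  have co: "coeff (coeff (coeff A i) j) k \<noteq> 0 \<Longrightarrow> i + j + k = Suc d" for i j k
    using assms by (simp add: form_def)
  have "c = 0"
    using co[of 0 0 0] by (auto simp: A a b)
  moreover have "form d A1"
    using co[of "Suc _"] by (auto simp: form_def A)
  moreover have "form d [:A2:]"
    using co[of 0 "Suc _"] by (auto simp: form_def A a coeff_pCons split: nat.splits)
  moreover have "form d [:[:A3:]:]"
    using co[of 0 0 "Suc _"] by (auto simp: form_def A a b coeff_pCons split: nat.splits)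
  ultimately show thesis
    by (intro that[of A1 "[:A2:]" "[:[:A3:]:]"])
      (simp_all add: A a b varX_def varY_def varZ_def)
qed

section \<open>The gradient\<close>

definition gradient :: "poly3 \<Rightarrow> complex^3 \<Rightarrow> complex^3" where
  "gradient F v = vector [eval3 (partialX F) v, eval3 (partialY F) v, eval3 (partialZ F) v]"

lemma tangent_line_eq_linear_form: "tangent_line F P = linear_form (gradient F (hcoords P))"
  by (simp add: tangent_line_def linear_form_def gradient_def)

lemma map_poly_derivation:
  fixes \<delta> :: "'a :: comm_ring_1 \<Rightarrow> 'a"
  assumes add: "\<And>a b. \<delta> (a + b) = \<delta> a + \<delta> b"
    and mult: "\<And>a b. \<delta> (a * b) = a * \<delta> b + b * \<delta> a"
  shows "map_poly \<delta> (p + q) = map_poly \<delta> p + map_poly \<delta> q"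
    and "map_poly \<delta> (p * q) = p * map_poly \<delta> q + q * map_poly \<delta> p"
proof -
  have zero: "\<delta> 0 = 0"
    using add[of 0 0] by simp
  have sum: "\<delta> (sum f A) = (\<Sum>x\<in>A. \<delta> (f x))" for f and A :: "nat set"
    by (induction A rule: infinite_finite_induct) (simp_all add: zero add)
  show "map_poly \<delta> (p + q) = map_poly \<delta> p + map_poly \<delta> q"
    by (simp add: poly_eq_iff coeff_map_poly zero add)
  have "coeff (map_poly \<delta> (p * q)) n = coeff (p * map_poly \<delta> q + map_poly \<delta> p * q) n" for n
    by (simp add: coeff_map_poly zero coeff_mult sum mult sum.distrib) (simp add: mult.commute)
  then show "map_poly \<delta> (p * q) = p * map_poly \<delta> q + q * map_poly \<delta> p"
    by (simp add: poly_eq_iff mult.commute)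
qed

lemma partial_add:
  "partialX (A + B) = partialX A + partialX B"
  "partialY (A + B) = partialY A + partialY B"
  "partialZ (A + B) = partialZ A + partialZ B"
  by (simp_all add: partialX_def partialY_def partialZ_def pderiv_add pderiv_mult map_poly_derivation)

lemma partial_mult:
  "partialX (A * B) = A * partialX B + B * partialX A"
  "partialY (A * B) = A * partialY B + B * partialY A"
  "partialZ (A * B) = A * partialZ B + B * partialZ A"
  by (simp_all add: partialX_def partialY_def partialZ_def pderiv_add pderiv_mult map_poly_derivation)

lemma gradient_add [simp]: "gradient (A + B) v = gradient A v + gradient B v"
  by (simp add: gradient_def partial_add vec_eq_iff forall_3)

lemma gradient_mult: "gradient (A * B) v = eval3 A v *s gradient B v + eval3 B v *s gradient A v"
  by (simp add: gradient_def partial_mult vec_eq_iff forall_3)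

lemma gradient_const3 [simp]: "gradient (const3 c) v = 0"
  by (simp add: gradient_def partialX_def partialY_def partialZ_def const3_def vec_eq_iff forall_3
      map_poly_pCons pderiv_pCons)

lemma gradient_vars [simp]:
  "gradient varX v = axis 1 1" "gradient varY v = axis 2 1" "gradient varZ v = axis 3 1"
  by (simp_all add: gradient_def partialX_def partialY_def partialZ_def varX_def varY_def varZ_def
      map_poly_pCons pderiv_pCons eval3_def vec_eq_iff forall_3 axis_def one_pCons)

lemma gradient_linear_form [simp]: "gradient (linear_form w) v = w"
  by (simp add: linear_form_def gradient_mult vec_eq_iff forall_3 axis_def)

section \<open>Points and coordinate frames\<close>

lemma hcoords_nonzero: "hcoords P \<noteq> 0"
  using Quotient3_rep_reflp[OF Quotient3_proj_plane] by (auto simp: proj_rel_def)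

lemma hcoords_proj_point:
  assumes "v \<noteq> 0"
  obtains c where "c \<noteq> 0" "hcoords (proj_point v) = c *s v"
proof -
  have "proj_rel v v"
    using assms by (auto simp: proj_rel_def intro: exI[of _ 1])
  then have "proj_rel (hcoords (proj_point v)) v"
    using rep_abs_rsp_left[OF Quotient3_proj_plane] by blast
  then obtain c where "c \<noteq> 0" "v = c *s hcoords (proj_point v)"
    by (auto simp: proj_rel_def)
  then have "hcoords (proj_point v) = inverse c *s v" "inverse c \<noteq> 0"
    by (simp_all add: vec_eq_iff)
  then show thesis
    using that by blast
qed

lemma proj_plane_eqI:
  assumes "hcoords Q = c *s hcoords P"
  shows "P = Q"
proof -
  have "c \<noteq> 0"
    using assms hcoords_nonzero[of Q] by auto
  then have "proj_rel (hcoords P) (hcoords Q)"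
    using assms hcoords_nonzero by (auto simp: proj_rel_def)
  then show ?thesis
    using Quotient3_rel_rep[OF Quotient3_proj_plane] by metis
qed

text \<open>Projective coordinates adapted to a point: linear forms \<open>n, l, t\<close> with the dual basis \<open>p, r, q\<close> of
  vectors. The point is \<open>p\<close>, where \<open>l\<close> and \<open>t\<close> vanish.\<close>

definition frame ::
  "complex^3 \<Rightarrow> complex^3 \<Rightarrow> complex^3 \<Rightarrow> complex^3 \<Rightarrow> complex^3 \<Rightarrow> complex^3 \<Rightarrow> bool" where
  "frame n l t p r q \<longleftrightarrow>
     pairing n p = 1 \<and> pairing l p = 0 \<and> pairing t p = 0 \<and>
     pairing n r = 0 \<and> pairing l r = 1 \<and> pairing t r = 0 \<and>
     pairing n q = 0 \<and> pairing l q = 0 \<and> pairing t q = 1"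

text \<open>Duality says that a matrix is a one-sided inverse of another; for square matrices it is then
  two-sided, which gives both expansions.\<close>

lemma frame_expand:
  assumes "frame n l t p r q"
  shows "w = pairing w p *s n + pairing w r *s l + pairing w q *s t"
    and "v = pairing n v *s p + pairing l v *s r + pairing t v *s q"
proof -
  define A :: "complex^3^3" where "A = vector [n, l, t]"
  define B :: "complex^3^3" where "B = transpose (vector [p, r, q])"
  have "A ** B = mat 1"
    using assms by (simp add: A_def B_def frame_def pairing_def matrix_matrix_mult_def mat_def
        transpose_def vec_eq_iff forall_3 sum_3)
  then have "B ** A = mat 1"
    by (simp add: matrix_left_right_inverse)
  then have BA: "p $ i * n $ j + r $ i * l $ j + q $ i * t $ j = (if i = j then 1 else 0)" for i j
    by (simp add: A_def B_def matrix_matrix_mult_def mat_def transpose_def vec_eq_iff sum_3)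
  have "pairing w p * n $ j + pairing w r * l $ j + pairing w q * t $ j =
      w $ 1 * (p $ 1 * n $ j + r $ 1 * l $ j + q $ 1 * t $ j) +
      w $ 2 * (p $ 2 * n $ j + r $ 2 * l $ j + q $ 2 * t $ j) +
      w $ 3 * (p $ 3 * n $ j + r $ 3 * l $ j + q $ 3 * t $ j)" for j
    by (simp add: pairing_def algebra_simps)
  then show "w = pairing w p *s n + pairing w r *s l + pairing w q *s t"
    by (simp add: BA vec_eq_iff forall_3)
  have "pairing n v * p $ i + pairing l v * r $ i + pairing t v * q $ i =
      (p $ i * n $ 1 + r $ i * l $ 1 + q $ i * t $ 1) * v $ 1 +
      (p $ i * n $ 2 + r $ i * l $ 2 + q $ i * t $ 2) * v $ 2 +
      (p $ i * n $ 3 + r $ i * l $ 3 + q $ i * t $ 3) * v $ 3" for i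
    by (simp add: pairing_def algebra_simps)
  then show "v = pairing n v *s p + pairing l v *s r + pairing t v *s q"
    by (simp add: BA vec_eq_iff forall_3)
qed

lemma frame_exists:
  assumes "p \<noteq> 0"
  obtains n l t r q where "frame n l t p r q"
proof -
  consider "p $ 1 \<noteq> 0" | "p $ 2 \<noteq> 0" | "p $ 3 \<noteq> 0"
    using assms by (auto simp: vec_eq_iff forall_3)
  then show thesis
  proof cases
    case 1
    then have "frame (vector [1 / p $ 1, 0, 0]) (vector [- p $ 2 / p $ 1, 1, 0])
        (vector [- p $ 3 / p $ 1, 0, 1]) p (vector [0, 1, 0]) (vector [0, 0, 1])"
      by (simp add: frame_def pairing_def)
    then show ?thesis by (rule that)
  next
    case 2
    then have "frame (vector [0, 1 / p $ 2, 0]) (vector [1, - p $ 1 / p $ 2, 0])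
        (vector [0, - p $ 3 / p $ 2, 1]) p (vector [1, 0, 0]) (vector [0, 0, 1])"
      by (simp add: frame_def pairing_def)
    then show ?thesis by (rule that)
  next
    case 3
    then have "frame (vector [0, 0, 1 / p $ 3]) (vector [1, 0, - p $ 1 / p $ 3])
        (vector [0, 1, - p $ 2 / p $ 3]) p (vector [1, 0, 0]) (vector [0, 1, 0])"
      by (simp add: frame_def pairing_def)
    then show ?thesis by (rule that)
  qed
qed

text \<open>An exchange step: \<open>t\<close> is a combination of \<open>u\<close> and \<open>v\<close> and may replace one of them.\<close>

lemma frame_with_last_covector:
  assumes fr: "frame n u v p r q" and t: "t \<noteq> 0" "pairing t p = 0"
  obtains l r' q' where "frame n l t p r' q'"
proof (cases "pairing t r = 0")
  case False
  have "frame n v t p (q - (pairing t q / pairing t r) *s r) ((1 / pairing t r) *s r)"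
    using fr t False by (simp add: frame_def)
  then show thesis by (rule that)
next
  case True
  then have "pairing t q \<noteq> 0"
    using frame_expand(1)[OF fr, of t] t by auto
  then have "frame n u t p r ((1 / pairing t q) *s q)"
    using fr t True by (simp add: frame_def)
  then show thesis by (rule that)
qed

text \<open>Changing the line \<open>n\<close> within the pencil spanned by \<open>n\<close> and \<open>l\<close> moves the dual point \<open>r\<close> along the
  line \<open>t = 0\<close> and leaves \<open>p\<close> fixed. A suitable \<open>c\<close> brings \<open>r\<close> to the residual intersection point of a cubic with
  tangent \<open>t\<close> at \<open>p\<close>.\<close>

lemma frame_shear:
  assumes "frame n l t p r q"
  shows "frame (n + c *s l) l t p (r - c *s p) q"
  using assms by (simp add: frame_def)

text \<open>The splitting along \<open>x, y, z\<close>, transported to an arbitrary frame. It replaces a linear change of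
  coordinates in polynomials.\<close>

lemma form_Suc_split:
  assumes fr: "frame n l t p r q" and A: "form (Suc d) A"
  obtains A0 A1 A2 where "form d A0" "form d A1" "form d A2"
    "A = linear_form n * A0 + linear_form l * A1 + linear_form t * A2"
proof -
  obtain X Y Z where XYZ: "form d X" "form d Y" "form d Z" "A = varX * X + varY * Y + varZ * Z"
    using form_Suc_split_vars[OF A] .
  have var: "linear_form w = const3 (pairing w p) * linear_form n +
      const3 (pairing w r) * linear_form l + const3 (pairing w q) * linear_form t" for w
    using arg_cong[OF frame_expand(1)[OF fr, of w], of linear_form]
    by (simp add: linear_form_add linear_form_scale)
  define part where "part v = const3 (v $ 1) * X + const3 (v $ 2) * Y + const3 (v $ 3) * Z" for v :: "complex^3"
  have "form d (part v)" for v
    unfolding part_def by (intro form_add form_scale XYZ)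
  moreover have "A = linear_form n * part p + linear_form l * part r + linear_form t * part q"
    unfolding XYZ(4) part_def linear_form_axis[symmetric]
    by (simp only: var[of "axis _ 1"]) (simp add: pairing_def axis_def algebra_simps)
  ultimately show thesis
    by (intro that[of "part p" "part r" "part q"])
qed

section \<open>The local ring at a point\<close>

lemma to_fract_power: "to_fract (A ^ k) = to_fract A ^ k"
  by (induction k) simp_all

lemma local_ringI:
  assumes "form d A" "form d B" "eval3 B (hcoords P) \<noteq> 0"
  shows "to_fract A / to_fract B \<in> local_ring P"
  using assms unfolding local_ring_def on_curve_def Fract_conv_to_fract by blast

lemma local_ringE:
  assumes "h \<in> local_ring P"
  obtains d A B where "form d A" "form d B" "eval3 B (hcoords P) \<noteq> 0" "B \<noteq> 0"
    "h = to_fract A / to_fract B"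
  using assms unfolding local_ring_def on_curve_def Fract_conv_to_fract by force

lemma local_ring_const: "to_fract (const3 c) \<in> local_ring P"
  using local_ringI[OF form_const3[of c] form_const3[of 1]] by simp

lemma local_ring_0: "0 \<in> local_ring P" and local_ring_1: "1 \<in> local_ring P"
  using local_ring_const[of 0] local_ring_const[of 1] by simp_all

lemma local_ring_mult:
  assumes "g \<in> local_ring P" "h \<in> local_ring P"
  shows "g * h \<in> local_ring P"
proof -
  obtain d A B where g: "form d A" "form d B" "eval3 B (hcoords P) \<noteq> 0" "g = to_fract A / to_fract B"
    using assms(1) by (rule local_ringE)
  obtain e A' B' where h: "form e A'" "form e B'" "eval3 B' (hcoords P) \<noteq> 0" "h = to_fract A' / to_fract B'"
    using assms(2) by (rule local_ringE)
  have "to_fract (A * A') / to_fract (B * B') \<in> local_ring P"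
    by (rule local_ringI[of "d + e"]) (use g h in \<open>simp_all add: form_mult\<close>)
  then show ?thesis
    by (simp add: g(4) h(4))
qed

lemma local_ring_add:
  assumes "g \<in> local_ring P" "h \<in> local_ring P"
  shows "g + h \<in> local_ring P"
proof -
  obtain d A B where g: "form d A" "form d B" "eval3 B (hcoords P) \<noteq> 0" "B \<noteq> 0" "g = to_fract A / to_fract B"
    using assms(1) by (rule local_ringE)
  obtain e A' B' where h: "form e A'" "form e B'" "eval3 B' (hcoords P) \<noteq> 0" "B' \<noteq> 0" "h = to_fract A' / to_fract B'"
    using assms(2) by (rule local_ringE)
  have "form (d + e) (B * A')" "form (d + e) (A * B')" "form (d + e) (B * B')"
    using g h by (simp_all add: form_mult)
  then have "to_fract (A * B' + B * A') / to_fract (B * B') \<in> local_ring P"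
    using g(3) h(3) by (intro local_ringI form_add) simp_all
  also have "to_fract (A * B' + B * A') / to_fract (B * B') = g + h"
    using g h by (simp add: field_simps)
  finally show ?thesis .
qed

lemma local_ring_uminus: "h \<in> local_ring P \<Longrightarrow> - h \<in> local_ring P"
  using local_ring_mult[OF local_ring_const[of "-1"]] by (simp add: const3_uminus)

lemma local_ring_power: "h \<in> local_ring P \<Longrightarrow> h ^ k \<in> local_ring P"
  by (induction k) (auto intro: local_ring_1 local_ring_mult)

text \<open>The local equations of a curve differ by units, so two of them suffice as generators of the ideal:
  those with a power of one linear form as denominator.\<close>

lemma local_ideal_eq:
  assumes F: "form d F" "F \<noteq> 0" and G: "form e G" "G \<noteq> 0"
    and y: "pairing y (hcoords P) \<noteq> 0"
  shows "local_ideal F G P =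
    {a * (to_fract F / to_fract (linear_form y) ^ d) + b * (to_fract G / to_fract (linear_form y) ^ e) | a b.
      a \<in> local_ring P \<and> b \<in> local_ring P}" (is "_ = ?R")
proof -
  define Y where "Y = linear_form y"
  have Y: "Y \<noteq> 0" "form k (Y ^ k)" "eval3 (Y ^ k) (hcoords P) \<noteq> 0" for k
    using y by (auto simp: Y_def form_linear_form_power simp flip: eval3_linear_form)
  have local_equations_form: "\<exists>v\<in>local_ring P. f = v * (to_fract H / to_fract Y ^ k)"
    if H: "form k H" "H \<noteq> 0" and f: "f \<in> local_equations H P" for k H f
  proof -
    obtain U where U: "form k U" "eval3 U (hcoords P) \<noteq> 0" "f = to_fract H / to_fract U"
      using f form_degree_unique[OF H(1) _ H(2)]
      by (auto simp: local_equations_def on_curve_def Fract_conv_to_fract)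
    then have "to_fract (Y ^ k) / to_fract U \<in> local_ring P"
      by (intro local_ringI[OF Y(2)])
    moreover have "f = (to_fract (Y ^ k) / to_fract U) * (to_fract H / to_fract Y ^ k)"
      using U Y(1) by (simp add: to_fract_power)
    ultimately show ?thesis by blast
  qed
  have eq_in: "to_fract H / to_fract Y ^ k \<in> local_equations H P" if "form k H" for k H
    using that Y(2,3)[of k]
    unfolding local_equations_def on_curve_def Fract_conv_to_fract to_fract_power[symmetric] by blast
  have "local_ideal F G P \<subseteq> ?R"
  proof
    fix h assume "h \<in> local_ideal F G P"
    then obtain a b f g where h: "h = a * f + b * g" "a \<in> local_ring P" "b \<in> local_ring P"
      "f \<in> local_equations F P" "g \<in> local_equations G P"
      by (auto simp: local_ideal_def)
    obtain v w where "v \<in> local_ring P" "f = v * (to_fract F / to_fract Y ^ d)"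
      "w \<in> local_ring P" "g = w * (to_fract G / to_fract Y ^ e)"
      using local_equations_form[OF F h(4)] local_equations_form[OF G h(5)] by blast
    then have "h = (a * v) * (to_fract F / to_fract Y ^ d) + (b * w) * (to_fract G / to_fract Y ^ e)"
      "a * v \<in> local_ring P" "b * w \<in> local_ring P"
      using h by (simp_all add: local_ring_mult mult.assoc)
    then show "h \<in> ?R"
      unfolding Y_def by blast
  qed
  moreover have "?R \<subseteq> local_ideal F G P"
    using eq_in[OF F(1)] eq_in[OF G(1)] unfolding local_ideal_def Y_def by blast
  ultimately show ?thesis by blast
qed

text \<open>By Gaussian elimination, one equation at a time. The elements of \<open>B\<close> index the unknowns.\<close>

lemma homogeneous_system_nontrivial:
  fixes M :: "'b \<Rightarrow> nat \<Rightarrow> 'a :: field"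
  assumes "finite B" "k < card B"
  shows "\<exists>c. (\<exists>b\<in>B. c b \<noteq> 0) \<and> (\<forall>i<k. (\<Sum>b\<in>B. c b * M b i) = 0)"
  using assms
proof (induction k arbitrary: B M)
  case 0
  then show ?case
    by (intro exI[of _ "\<lambda>_. 1"]) (auto simp: card_gt_0_iff)
next
  case (Suc k)
  show ?case
  proof (cases "\<forall>b\<in>B. M b k = 0")
    case True
    then show ?thesis
      using Suc.IH[of B M] Suc.prems by (auto simp: less_Suc_eq)
  next
    case False
    then obtain b0 where b0: "b0 \<in> B" "M b0 k \<noteq> 0" by blast
    define B' where "B' = B - {b0}"
    define M' where "M' b i = M b i - M b k / M b0 k * M b0 i" for b i
    have B: "B = insert b0 B'" "b0 \<notin> B'" "finite B'" "k < card B'"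
      using b0 Suc.prems by (auto simp: B'_def)
    then obtain c where c: "\<exists>b\<in>B'. c b \<noteq> 0" "\<forall>i<k. (\<Sum>b\<in>B'. c b * M' b i) = 0"
      using Suc.IH[of B' M'] by blast
    define c' where "c' = c(b0 := - (\<Sum>b\<in>B'. c b * (M b k / M b0 k)))"
    have "(\<Sum>b\<in>B. c' b * M b i) = (\<Sum>b\<in>B'. c b * M' b i)" for i
    proof -
      have "(\<Sum>b\<in>B'. c' b * M b i) = (\<Sum>b\<in>B'. c b * M b i)"
        by (rule sum.cong) (use B in \<open>auto simp: c'_def\<close>)
      then show ?thesis
        using B by (simp add: c'_def M'_def right_diff_distrib sum_subtractf sum_distrib_right mult.assoc)
    qed
    moreover have "M' b k = 0" for b
      using b0 by (simp add: M'_def)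
    moreover have "\<exists>b\<in>B. c' b \<noteq> 0"
      using c(1) B by (auto simp: c'_def)
    ultimately show ?thesis
      using c(2) by (intro exI[of _ c']) (auto simp: less_Suc_eq)
  qed
qed

text \<open>Modulo the ideal, each member of \<open>B\<close> has a vector of \<open>k\<close> coordinates with respect to the spanning
  family \<open>e\<close>; more than \<open>k\<close> such vectors are linearly dependent.\<close>

lemma intersection_mult_le:
  fixes e :: "nat \<Rightarrow> poly3 fract"
  assumes zero: "0 \<in> local_ideal F G P"
    and add: "\<And>x y. x \<in> local_ideal F G P \<Longrightarrow> y \<in> local_ideal F G P \<Longrightarrow> x + y \<in> local_ideal F G P"
    and scale: "\<And>c x. x \<in> local_ideal F G P \<Longrightarrow> to_fract (const3 c) * x \<in> local_ideal F G P"
    and span: "\<And>h. h \<in> local_ring P \<Longrightarrow>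
      \<exists>c. h - (\<Sum>i<k. to_fract (const3 (c i)) * e i) \<in> local_ideal F G P"
  shows "intersection_mult F G P \<le> enat k"
  unfolding intersection_mult_def
proof (rule Sup_least, clarify)
  fix B assume B: "finite B" "B \<subseteq> local_ring P" "lin_indep_mod (local_ideal F G P) B"
  have "\<forall>b\<in>B. \<exists>c. b - (\<Sum>i<k. to_fract (const3 (c i)) * e i) \<in> local_ideal F G P"
    using span B(2) by blast
  then obtain M where M: "\<And>b. b \<in> B \<Longrightarrow> b - (\<Sum>i<k. to_fract (const3 (M b i)) * e i) \<in> local_ideal F G P"
    by metis
  show "enat (card B) \<le> enat k"
  proof (rule ccontr)
    assume "\<not> enat (card B) \<le> enat k"
    then obtain c where c: "\<exists>b\<in>B. c b \<noteq> 0" "\<And>i. i < k \<Longrightarrow> (\<Sum>b\<in>B. c b * M b i) = 0"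
      using homogeneous_system_nontrivial[OF B(1), of k M] by auto
    have const3_sum: "to_fract (const3 (sum f B)) = (\<Sum>b\<in>B. to_fract (const3 (f b)))" for f
      by (induction B rule: infinite_finite_induct) (simp_all add: const3_add)
    have sum_in: "sum f B' \<in> local_ideal F G P" if "\<And>b. b \<in> B' \<Longrightarrow> f b \<in> local_ideal F G P" for f B'
      using that by (induction B' rule: infinite_finite_induct) (auto simp: zero add)
    have "(\<Sum>b\<in>B. to_fract (const3 (c b)) * (\<Sum>i<k. to_fract (const3 (M b i)) * e i)) =
        (\<Sum>i<k. \<Sum>b\<in>B. to_fract (const3 (c b)) * to_fract (const3 (M b i)) * e i)"
      by (subst sum.swap) (simp add: sum_distrib_left mult.assoc)
    also have "\<dots> = (\<Sum>i<k. to_fract (const3 (\<Sum>b\<in>B. c b * M b i)) * e i)"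
      by (simp add: const3_sum const3_mult sum_distrib_right)
    also have "\<dots> = 0"
      by (simp add: c(2))
    finally have "(\<Sum>b\<in>B. to_fract (const3 (c b)) * b) =
        (\<Sum>b\<in>B. to_fract (const3 (c b)) * (b - (\<Sum>i<k. to_fract (const3 (M b i)) * e i)))"
      by (simp add: right_diff_distrib sum_subtractf)
    also have "\<dots> \<in> local_ideal F G P"
      by (intro sum_in scale M)
    finally show False
      using B(3) c(1) unfolding lin_indep_mod_def to_fract_def by blast
  qed
qed

section \<open>Order of contact with a curve\<close>

text \<open>The polynomials that vanish to order at least \<open>k\<close> along \<open>F\<close> at \<open>p\<close>, when \<open>l\<close> is a uniformizer there:
  the ideal \<open>(l\<^sup>k, F)\<close>, localised at \<open>p\<close>. The localisation is taken on the
  affine cone, which makes this an ideal of the whole polynomial ring.\<close>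

definition contact_ideal :: "poly3 \<Rightarrow> complex^3 \<Rightarrow> complex^3 \<Rightarrow> nat \<Rightarrow> poly3 set" where
  "contact_ideal F l p k =
     {G. \<exists>W A B. eval3 W p \<noteq> 0 \<and> W * G = linear_form l ^ k * A + F * B}"

lemma contact_idealI:
  "eval3 W p \<noteq> 0 \<Longrightarrow> W * G = linear_form l ^ k * A + F * B \<Longrightarrow> G \<in> contact_ideal F l p k"
  unfolding contact_ideal_def by blast

lemma contact_ideal_curve: "F * B \<in> contact_ideal F l p k"
  by (rule contact_idealI[of 1 _ _ _ _ 0 _ B]) simp_all

lemma contact_ideal_power: "k \<le> j \<Longrightarrow> linear_form l ^ j * A \<in> contact_ideal F l p k"
  by (rule contact_idealI[of 1 _ _ _ _ "linear_form l ^ (j - k) * A" _ 0])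
    (simp_all flip: power_add mult.assoc)

lemma contact_ideal_add:
  assumes "G \<in> contact_ideal F l p k" "H \<in> contact_ideal F l p k"
  shows "G + H \<in> contact_ideal F l p k"
proof -
  obtain W A B where G: "eval3 W p \<noteq> 0" "W * G = linear_form l ^ k * A + F * B"
    using assms(1) by (auto simp: contact_ideal_def)
  obtain W' A' B' where H: "eval3 W' p \<noteq> 0" "W' * H = linear_form l ^ k * A' + F * B'"
    using assms(2) by (auto simp: contact_ideal_def)
  show ?thesis
  proof (rule contact_idealI)
    show "eval3 (W * W') p \<noteq> 0"
      using G H by simp
    have "W * W' * (G + H) = W' * (W * G) + W * (W' * H)"
      by (simp add: algebra_simps)
    also have "\<dots> = linear_form l ^ k * (W' * A + W * A') + F * (W' * B + W * B')"
      unfolding G(2) H(2) by (simp add: algebra_simps)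
    finally show "W * W' * (G + H) = linear_form l ^ k * (W' * A + W * A') + F * (W' * B + W * B')" .
  qed
qed

lemma contact_ideal_times:
  assumes "G \<in> contact_ideal F l p i" "H \<in> contact_ideal F l p j"
  shows "G * H \<in> contact_ideal F l p (i + j)"
proof -
  obtain W A B where G: "eval3 W p \<noteq> 0" "W * G = linear_form l ^ i * A + F * B"
    using assms(1) by (auto simp: contact_ideal_def)
  obtain W' A' B' where H: "eval3 W' p \<noteq> 0" "W' * H = linear_form l ^ j * A' + F * B'"
    using assms(2) by (auto simp: contact_ideal_def)
  show ?thesis
  proof (rule contact_idealI)
    show "eval3 (W * W') p \<noteq> 0"
      using G H by simp
    have "W * W' * (G * H) = (W * G) * (W' * H)"
      by (simp add: algebra_simps)
    also have "\<dots> = linear_form l ^ (i + j) * (A * A') +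
        F * (B * (linear_form l ^ j * A' + F * B') + linear_form l ^ i * A * B')"
      unfolding G(2) H(2) by (simp add: algebra_simps power_add)
    finally show "W * W' * (G * H) = linear_form l ^ (i + j) * (A * A') +
        F * (B * (linear_form l ^ j * A' + F * B') + linear_form l ^ i * A * B')" .
  qed
qed

lemma contact_ideal_mult: "G \<in> contact_ideal F l p k \<Longrightarrow> A * G \<in> contact_ideal F l p k"
  using contact_ideal_times[OF contact_ideal_power[of 0 0 l A F p]] by simp

lemma contact_ideal_diff:
  "G \<in> contact_ideal F l p k \<Longrightarrow> H \<in> contact_ideal F l p k \<Longrightarrow> G - H \<in> contact_ideal F l p k"
  using contact_ideal_add[of G F l p k "-1 * H"] contact_ideal_mult[of H F l p k "-1"] by simp

lemma contact_ideal_mono: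
  assumes "G \<in> contact_ideal F l p j" "k \<le> j"
  shows "G \<in> contact_ideal F l p k"
proof -
  obtain W A B where G: "eval3 W p \<noteq> 0" "W * G = linear_form l ^ j * A + F * B"
    using assms(1) by (auto simp: contact_ideal_def)
  have "W * G = linear_form l ^ k * (linear_form l ^ (j - k) * A) + F * B"
    using assms(2) by (simp add: G flip: mult.assoc power_add)
  with G(1) show ?thesis
    by (rule contact_idealI)
qed

lemma contact_ideal_saturated:
  assumes "eval3 W p \<noteq> 0" "W * G \<in> contact_ideal F l p k"
  shows "G \<in> contact_ideal F l p k"
proof -
  obtain V A B where "eval3 V p \<noteq> 0" "V * (W * G) = linear_form l ^ k * A + F * B"
    using assms(2) by (auto simp: contact_ideal_def)
  with assms(1) show ?thesis
    by (intro contact_idealI[of "V * W"]) (simp_all add: mult.assoc)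
qed

lemma contact_ideal_vanish:
  assumes "G \<in> contact_ideal F l p (Suc k)" "eval3 F p = 0" "pairing l p = 0"
  shows "eval3 G p = 0"
proof -
  obtain W A B where W: "eval3 W p \<noteq> 0" "W * G = linear_form l ^ Suc k * A + F * B"
    using assms(1) by (auto simp: contact_ideal_def)
  have "eval3 (W * G) p = 0"
    unfolding W(2) using assms by simp
  with W(1) show ?thesis by simp
qed

text \<open>This is what makes contact order behave like a valuation: \<open>l\<close> is not a zero divisor modulo \<open>F\<close>,
  since it is prime and does not divide \<open>F\<close>.\<close>

lemma contact_ideal_cancel:
  assumes "linear_form l * G \<in> contact_ideal F l p (Suc k)" "l \<noteq> 0" "\<not> linear_form l dvd F"
  shows "G \<in> contact_ideal F l p k"
proof -
  define L where "L = linear_form l"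
  have L: "prime_elem L"
    unfolding L_def by (rule linear_form_prime) fact
  obtain W A B where W: "eval3 W p \<noteq> 0" "W * (L * G) = L ^ Suc k * A + F * B"
    using assms(1) by (auto simp: contact_ideal_def L_def)
  then have "F * B = L * (W * G - L ^ k * A)"
    by (simp add: algebra_simps)
  then have "L dvd B"
    using L assms(3) prime_elem_dvd_mult_iff[OF L, of F B] by (auto simp: L_def)
  then obtain B' where "B = L * B'" ..
  with W(2) have "L * (W * G) = L * (L ^ k * A + F * B')"
    by (simp add: algebra_simps)
  then have "W * G = L ^ k * A + F * B'"
    using L by (simp add: prime_elem_def)
  with W(1) show ?thesis
    unfolding L_def by (rule contact_idealI)
qed

text \<open>The powers \<open>1, u, \<dots>, u\<^sup>k\<^sup>-\<^sup>1\<close> of the uniformizer \<open>u = x/y\<close> are independent modulo order \<open>k\<close>, stated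
  after clearing the denominator \<open>y\<^sup>k\<close>: evaluation at \<open>p\<close> kills \<open>c 0\<close>, and then a factor \<open>x\<close> cancels.\<close>

lemma contact_ideal_homogeneous_sum:
  fixes c :: "nat \<Rightarrow> complex"
  assumes "(\<Sum>i<k. const3 (c i) * (linear_form x ^ i * linear_form y ^ (k - i))) \<in> contact_ideal G x p k"
    and "eval3 G p = 0" "pairing x p = 0" "pairing y p \<noteq> 0" "x \<noteq> 0" "\<not> linear_form x dvd G"
  shows "\<forall>i<k. c i = 0"
  using assms(1)
proof (induction k arbitrary: c)
  case (Suc k)
  define H where "H = (\<Sum>i<k. const3 (c (Suc i)) * (linear_form x ^ i * linear_form y ^ (k - i)))"
  have S: "const3 (c 0) * linear_form y ^ Suc k + linear_form x * H \<in> contact_ideal G x p (Suc k)"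
    using Suc.prems unfolding sum.lessThan_Suc_shift
    by (simp add: H_def sum_distrib_left algebra_simps)
  then have c0: "c 0 = 0"
    using contact_ideal_vanish[OF S] assms by auto
  with S have "H \<in> contact_ideal G x p k"
    using assms contact_ideal_cancel by auto
  then have "\<forall>i<k. c (Suc i) = 0"
    using Suc.IH by (simp add: H_def)
  with c0 show ?case
    using less_Suc_eq_0_disj by auto
qed simp

text \<open>The equation \<open>FG\<close> puts \<open>F\<close> into the contact ideal of order \<open>k\<close> along \<open>G\<close>, hence the whole local
  ideal of \<open>F\<close> and \<open>G\<close>. So the powers of \<open>x/y\<close> below \<open>k\<close> are independent modulo that ideal.\<close>

lemma intersection_mult_ge:
  assumes F: "form d F" "F \<noteq> 0" and G: "form e G" "G \<noteq> 0" "eval3 G (hcoords P) = 0"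
    and xy: "pairing x (hcoords P) = 0" "pairing y (hcoords P) \<noteq> 0" "x \<noteq> 0" "\<not> linear_form x dvd G"
    and FG: "F = linear_form x ^ k * A + G * B"
  shows "enat k \<le> intersection_mult F G P"
proof -
  define p where "p = hcoords P"
  define X where "X = linear_form x"
  define Y where "Y = linear_form y"
  define u where "u = to_fract X / to_fract Y"
  have Y: "Y \<noteq> 0" "eval3 Y p \<noteq> 0"
    using xy(2) by (auto simp: Y_def p_def simp flip: eval3_linear_form)
  have indep: "\<forall>i<k. c i = 0"
    if I: "(\<Sum>i<k. to_fract (const3 (c i)) * u ^ i) \<in> local_ideal F G P" for c
  proof -
    obtain a b where ab: "a \<in> local_ring P" "b \<in> local_ring P"
      "(\<Sum>i<k. to_fract (const3 (c i)) * u ^ i) = a * (to_fract F / to_fract Y ^ d) + b * (to_fract G / to_fract Y ^ e)"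
      using I unfolding local_ideal_eq[OF F G(1,2) xy(2)] Y_def by blast
    obtain A1 B1 where a: "eval3 B1 p \<noteq> 0" "B1 \<noteq> 0" "a = to_fract A1 / to_fract B1"
      using ab(1) unfolding p_def by (rule local_ringE)
    obtain A2 B2 where b: "eval3 B2 p \<noteq> 0" "B2 \<noteq> 0" "b = to_fract A2 / to_fract B2"
      using ab(2) unfolding p_def by (rule local_ringE)
    define H where "H = (\<Sum>i<k. const3 (c i) * (X ^ i * Y ^ (k - i)))"
    have "to_fract Y ^ k * u ^ i = to_fract X ^ i * to_fract Y ^ (k - i)" if "i < k" for i
      using power_add[of "to_fract Y" i "k - i"] Y that by (simp add: u_def power_divide field_simps)
    then have "to_fract H = (\<Sum>i<k. to_fract Y ^ k * (to_fract (const3 (c i)) * u ^ i))"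
      unfolding H_def to_fract_sum
      by (intro sum.cong) (simp_all add: to_fract_power mult.left_commute)
    also have "\<dots> = to_fract Y ^ k * (a * (to_fract F / to_fract Y ^ d) + b * (to_fract G / to_fract Y ^ e))"
      by (simp add: ab(3) flip: sum_distrib_left)
    finally have "to_fract (B1 * B2 * Y ^ d * Y ^ e * H) =
        to_fract (F * (Y ^ k * Y ^ e * A1 * B2) + G * (Y ^ k * Y ^ d * A2 * B1))"
      using Y a b by (simp add: to_fract_power field_simps)
    then have eq: "B1 * B2 * Y ^ d * Y ^ e * H = F * (Y ^ k * Y ^ e * A1 * B2) + G * (Y ^ k * Y ^ d * A2 * B1)"
      by (simp only: to_fract_eq_iff)
    have "H \<in> contact_ideal G x p k"
    proof (rule contact_idealI)
      show "eval3 (B1 * B2 * Y ^ d * Y ^ e) p \<noteq> 0"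
        using Y a b by simp
      show "B1 * B2 * Y ^ d * Y ^ e * H = linear_form x ^ k * (A * (Y ^ k * Y ^ e * A1 * B2)) +
          G * (B * (Y ^ k * Y ^ e * A1 * B2) + Y ^ k * Y ^ d * A2 * B1)"
        unfolding eq by (simp add: FG algebra_simps)
    qed
    then show ?thesis
      using contact_ideal_homogeneous_sum[where x = x and y = y and p = p and c = c] G(3) xy by (simp add: H_def X_def Y_def p_def)
  qed
  have u: "u \<in> local_ring P"
    unfolding u_def X_def Y_def by (rule local_ringI[OF form_linear_form form_linear_form]) (use xy in simp)
  have zero: "0 \<in> local_ideal F G P"
    unfolding local_ideal_eq[OF F G(1,2) xy(2)] using local_ring_0 by force
  \<comment> \<open>A coincidence of two powers would be a relation with coefficients 1 and -1.\<close>
  have inj: "inj_on (\<lambda>i. u ^ i) {..<k}"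
  proof (rule inj_onI, rule ccontr)
    fix i j assume ij: "i \<in> {..<k}" "j \<in> {..<k}" "u ^ i = u ^ j" "i \<noteq> j"
    define c :: "nat \<Rightarrow> complex" where "c m = (if m = i then 1 else 0) - (if m = j then 1 else 0)" for m
    have "(\<Sum>m<k. to_fract (const3 (c m)) * u ^ m) =
        (\<Sum>m<k. (if m = i then u ^ i else 0) - (if m = j then u ^ j else 0))"
      by (rule sum.cong) (auto simp: c_def const3_diff const3_uminus)
    also have "\<dots> = 0"
      using ij by (simp add: sum_subtractf)
    finally have "\<forall>m<k. c m = 0"
      using indep zero by simp
    with ij show False
      by (auto simp: c_def)
  qed
  define V where "V = (\<lambda>i. u ^ i) ` {..<k}"
  have "lin_indep_mod (local_ideal F G P) V"
    unfolding lin_indep_mod_def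
  proof (intro allI impI)
    fix c :: "poly3 fract \<Rightarrow> complex"
    assume "(\<Sum>b\<in>V. Fract (const3 (c b)) 1 * b) \<in> local_ideal F G P"
    then have "(\<Sum>i<k. to_fract (const3 (c (u ^ i))) * u ^ i) \<in> local_ideal F G P"
      unfolding V_def using inj by (simp add: sum.reindex to_fract_def)
    then show "\<forall>b\<in>V. c b = 0"
      using indep[of "\<lambda>i. c (u ^ i)"] by (auto simp: V_def)
  qed
  moreover have "finite V" "V \<subseteq> local_ring P" "card V = k"
    using inj u by (auto simp: V_def card_image intro: local_ring_power)
  ultimately show ?thesis
    unfolding intersection_mult_def by (intro Sup_upper) blast
qed

section \<open>Smooth points\<close>

text \<open>The homogeneous maximal ideal of the point \<open>p\<close> is generated by \<open>l\<close> and \<open>t\<close>.\<close>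

lemma form_vanishing_split:
  assumes fr: "frame n l t p r q" and "form (Suc e) A" "eval3 A p = 0"
  shows "\<exists>A1 A2. form e A1 \<and> form e A2 \<and> A = linear_form l * A1 + linear_form t * A2"
  using assms(2,3)
proof (induction e arbitrary: A)
  case 0
  obtain A0 A1 A2 where A: "form 0 A0" "form 0 A1" "form 0 A2"
    "A = linear_form n * A0 + linear_form l * A1 + linear_form t * A2"
    using form_Suc_split[OF fr 0(1)] .
  obtain c where "A0 = const3 c"
    using A(1) by (rule form_0D)
  with A fr 0(2) have "A0 = 0"
    by (simp add: frame_def)
  with A show ?case by auto
next
  case (Suc e)
  obtain A0 A1 A2 where A: "form (Suc e) A0" "form (Suc e) A1" "form (Suc e) A2"
    "A = linear_form n * A0 + linear_form l * A1 + linear_form t * A2"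
    using form_Suc_split[OF fr Suc.prems(1)] .
  have "eval3 A0 p = 0"
    using A fr Suc.prems(2) by (simp add: frame_def)
  then obtain B1 B2 where B: "form e B1" "form e B2" "A0 = linear_form l * B1 + linear_form t * B2"
    using Suc.IH A(1) by blast
  have "form (Suc e) (linear_form n * B1 + A1)" "form (Suc e) (linear_form n * B2 + A2)"
    using A B form_mult[OF form_linear_form] by (auto intro!: form_add)
  moreover have "A = linear_form l * (linear_form n * B1 + A1) + linear_form t * (linear_form n * B2 + A2)"
    by (simp add: A(4) B(3) algebra_simps)
  ultimately show ?case by blast
qed

text \<open>A curve \<open>F\<close> of degree \<open>d + 1\<close> near a smooth point \<open>P\<close>. Since \<open>Q(P) \<noteq> 0\<close>, the equation \<open>F = 0\<close> can be
  solved for \<open>t\<close> in the local ring: \<open>t = -lA/Q\<close>. Therefore \<open>u = l/n\<close> generates the maximal ideal modulo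
  the local equation \<open>f\<close>.\<close>

locale smooth_point =
  fixes P n l t r q d F A Q
  assumes frame: "frame n l t (hcoords P) r q"
    and form_A: "form d A" and form_Q: "form d Q"
    and F_eq: "F = linear_form l * A + linear_form t * Q"
    and Q_nonzero: "eval3 Q (hcoords P) \<noteq> 0"
begin

abbreviation "p \<equiv> hcoords P"
abbreviation "N \<equiv> linear_form n"
abbreviation "L \<equiv> linear_form l"
abbreviation "T \<equiv> linear_form t"

definition u :: "poly3 fract" where "u = to_fract L / to_fract N"
definition f :: "poly3 fract" where "f = to_fract F / to_fract N ^ Suc d"

lemma eval_p: "pairing n p = 1" "pairing l p = 0" "pairing t p = 0" "eval3 F p = 0"
  using frame by (simp_all add: frame_def F_eq)

lemma l_nonzero: "l \<noteq> 0"
  using frame by (auto simp: frame_def)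

lemma N_nonzero: "N \<noteq> 0"
  using eval_p(1) by (auto simp flip: eval3_linear_form)

lemma form_F: "form (Suc d) F"
  unfolding F_eq using form_mult[OF form_linear_form form_A] form_mult[OF form_linear_form form_Q]
  by (auto intro: form_add)

lemma not_L_dvd_F: "\<not> L dvd F"
proof
  assume "L dvd F"
  then have "L dvd T * Q"
    unfolding F_eq by (simp add: dvd_add_right_iff)
  then have "L dvd T \<or> L dvd Q"
    using linear_form_prime[OF l_nonzero] by (simp add: prime_elem_dvd_mult_iff)
  moreover have "\<not> L dvd T"
  proof
    assume "L dvd T"
    then obtain H where "T = L * H" ..
    then have "eval3 T q = eval3 L q * eval3 H q"
      by (simp only: eval3_mult)
    then show False
      using frame by (auto simp: frame_def)
  qed
  moreover have "\<not> L dvd Q"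
    using Q_nonzero eval_p(2) by (auto elim!: dvdE)
  ultimately show False by blast
qed

lemma F_nonzero: "F \<noteq> 0"
  using not_L_dvd_F by auto

lemma u_in: "u \<in> local_ring P"
  unfolding u_def by (rule local_ringI[OF form_linear_form form_linear_form]) (simp add: eval_p)

lemma vanishing_in_ideal:
  assumes AB: "form e B" "form e C" "eval3 C p \<noteq> 0" "eval3 B p = 0"
  shows "\<exists>a\<in>local_ring P. \<exists>b\<in>local_ring P. to_fract B / to_fract C = u * a + f * b"
proof (cases e)
  case 0
  with AB obtain c where "B = const3 c"
    using form_0D by blast
  with AB have "B = 0" by simp
  then show ?thesis
    by (intro bexI[of _ 0]) (simp_all add: local_ring_0)
next
  case (Suc e')
  obtain B1 B2 where B: "form e' B1" "form e' B2" "B = L * B1 + T * B2"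
    using form_vanishing_split[OF frame] AB(1,4) Suc by blast
  define X where "X = Q * B1 - A * B2"
  \<comment> \<open>Substitute \<open>TQ = F - LA\<close> into \<open>BQ\<close>.\<close>
  have eq: "B * Q = L * X + F * B2"
    by (simp add: X_def B F_eq algebra_simps)
  define a where "a = to_fract (N * X) / to_fract (C * Q)"
  define b where "b = to_fract (N ^ Suc d * B2) / to_fract (C * Q)"
  have "form (d + e') X"
    unfolding X_def by (intro form_diff form_mult form_A form_Q B)
  then have forms: "form (1 + (d + e')) (N * X)" "form (Suc d + e') (N ^ Suc d * B2)" "form (Suc e' + d) (C * Q)"
    using AB(2) Suc by (intro form_mult form_linear_form form_linear_form_power form_Q B; simp)+
  have "a \<in> local_ring P" "b \<in> local_ring P"
    unfolding a_def b_def
    by (rule local_ringI[of "Suc (d + e')"]; use forms AB(3) Q_nonzero in \<open>simp add: add.commute\<close>)+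
  moreover have "to_fract B / to_fract C = u * a + f * b"
  proof -
    have nz: "C \<noteq> 0" "Q \<noteq> 0" "N \<noteq> 0"
      using AB(3) Q_nonzero N_nonzero by auto
    have "u * a + f * b = (to_fract (L * X + F * B2)) / to_fract (C * Q)"
      using nz by (simp add: u_def f_def a_def b_def to_fract_power add_divide_distrib)
    also have "\<dots> = to_fract B / to_fract C"
      using nz by (simp flip: eq)
    finally show ?thesis ..
  qed
  ultimately show ?thesis by blast
qed

lemma residue:
  assumes "h \<in> local_ring P"
  obtains c a b where "a \<in> local_ring P" "b \<in> local_ring P" "h = to_fract (const3 c) + u * a + f * b"
proof -
  obtain e B C where h: "form e B" "form e C" "eval3 C p \<noteq> 0" "C \<noteq> 0" "h = to_fract B / to_fract C"
    using assms by (rule local_ringE)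
  define c where "c = eval3 B p / eval3 C p"
  have "form e (B - const3 c * C)" "eval3 (B - const3 c * C) p = 0"
    using h by (simp_all add: form_diff form_scale c_def)
  then obtain a b where ab: "a \<in> local_ring P" "b \<in> local_ring P"
    "to_fract (B - const3 c * C) / to_fract C = u * a + f * b"
    using vanishing_in_ideal h(2,3) by blast
  have "h - to_fract (const3 c) = to_fract (B - const3 c * C) / to_fract C"
    using h by (simp add: diff_divide_distrib)
  then have "h = to_fract (const3 c) + u * a + f * b"
    unfolding ab(3) by (simp add: algebra_simps)
  with ab(1,2) show thesis
    by (rule that)
qed

lemma unit_or_vanishing:
  assumes "h \<in> local_ring P"
  shows "(\<exists>v\<in>local_ring P. v * h = 1) \<or> (\<exists>a\<in>local_ring P. \<exists>b\<in>local_ring P. h = u * a + f * b)"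
proof -
  obtain e B C where h: "form e B" "form e C" "eval3 C p \<noteq> 0" "C \<noteq> 0" "h = to_fract B / to_fract C"
    using assms by (rule local_ringE)
  show ?thesis
  proof (cases "eval3 B p = 0")
    case True
    then show ?thesis
      using vanishing_in_ideal h by blast
  next
    case False
    then have "to_fract C / to_fract B * h = 1" "to_fract C / to_fract B \<in> local_ring P"
      using h by (auto intro: local_ringI)
    then show ?thesis by blast
  qed
qed

text \<open>Iterating the residue map gives the Taylor expansion in the uniformizer, up to order \<open>k\<close>.\<close>

lemma adic_expansion:
  assumes "h \<in> local_ring P"
  shows "\<exists>c. \<exists>a\<in>local_ring P. \<exists>b\<in>local_ring P.
    h = (\<Sum>i<k. to_fract (const3 (c i)) * u ^ i) + u ^ k * a + f * b"
proof (induction k)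
  case 0
  show ?case
    by (intro exI[of _ "\<lambda>_. 0"] bexI[of _ h] bexI[of _ 0]) (simp_all add: assms local_ring_0)
next
  case (Suc k)
  then obtain c a b where IH: "a \<in> local_ring P" "b \<in> local_ring P"
    "h = (\<Sum>i<k. to_fract (const3 (c i)) * u ^ i) + u ^ k * a + f * b"
    by blast
  obtain c' a' b' where a: "a' \<in> local_ring P" "b' \<in> local_ring P" "a = to_fract (const3 c') + u * a' + f * b'"
    using IH(1) by (rule residue)
  define c'' where "c'' = c(k := c')"
  have "(\<Sum>i<k. to_fract (const3 (c'' i)) * u ^ i) = (\<Sum>i<k. to_fract (const3 (c i)) * u ^ i)"
    by (rule sum.cong) (auto simp: c''_def)
  then have "h = (\<Sum>i<Suc k. to_fract (const3 (c'' i)) * u ^ i) + u ^ Suc k * a' + f * (b + u ^ k * b')"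
    by (simp add: IH(3) a(3) c''_def algebra_simps)
  moreover have "b + u ^ k * b' \<in> local_ring P"
    by (intro local_ring_add local_ring_mult local_ring_power u_in IH a)
  ultimately show ?case
    using a(1) by blast
qed

text \<open>Every element of the local ring either has order at least \<open>k\<close> along the curve, or is a unit times
  \<open>u\<^sup>j\<close> modulo \<open>f\<close> for some \<open>j < k\<close>. The second alternative is recorded by \<open>u\<^sup>j\<close> lying in the ideal of \<open>f\<close>
  and \<open>g\<close>.\<close>

lemma order_at_least_or_exactly:
  assumes "g \<in> local_ring P"
  shows "(\<exists>a\<in>local_ring P. \<exists>b\<in>local_ring P. g = u ^ k * a + f * b) \<or>
    (\<exists>j<k. \<exists>a\<in>local_ring P. \<exists>b\<in>local_ring P. u ^ j = g * a + f * b)"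
proof (induction k)
  case 0
  show ?case
    using assms local_ring_0 by (intro disjI1 bexI[of _ g] bexI[of _ 0]) auto
next
  case (Suc k)
  show ?case
  proof (cases "\<exists>j<k. \<exists>a\<in>local_ring P. \<exists>b\<in>local_ring P. u ^ j = g * a + f * b")
    case True
    then show ?thesis
      using less_SucI by blast
  next
    case False
    then obtain a b where g: "a \<in> local_ring P" "b \<in> local_ring P" "g = u ^ k * a + f * b"
      using Suc.IH by blast
    show ?thesis
      using unit_or_vanishing[OF g(1)]
    proof (elim disjE bexE)
      fix v assume v: "v \<in> local_ring P" "v * a = 1"
      have "g * v + f * - (v * b) = u ^ k * (v * a)"
        by (simp add: g(3) algebra_simps)
      then have "u ^ k = g * v + f * - (v * b)"
        by (simp add: v(2))
      moreover have "- (v * b) \<in> local_ring P"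
        by (intro local_ring_uminus local_ring_mult v g)
      ultimately show ?thesis
        using v(1) by blast
    next
      fix a' b' assume a: "a' \<in> local_ring P" "b' \<in> local_ring P" "a = u * a' + f * b'"
      have "g = u ^ Suc k * a' + f * (b + u ^ k * b')"
        by (simp add: g(3) a(3) algebra_simps)
      moreover have "b + u ^ k * b' \<in> local_ring P"
        by (intro local_ring_add local_ring_mult local_ring_power u_in g a)
      ultimately show ?thesis
        using a(1) by blast
    qed
  qed
qed

text \<open>If \<open>G\<close> had order \<open>j < k\<close> along \<open>F\<close>, then \<open>u\<^sup>j\<close> would lie in the local ideal, and by the expansion in
  \<open>u\<close> the powers of \<open>u\<close> below \<open>j\<close> would span the quotient. So the multiplicity would be at most \<open>j\<close>.\<close>

theorem contact_of_intersection_mult: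
  assumes G: "form e G" "G \<noteq> 0" and mult: "enat k \<le> intersection_mult F G P"
  shows "G \<in> contact_ideal F l p k"
proof -
  define g where "g = to_fract G / to_fract N ^ e"
  have "to_fract G / to_fract (N ^ e) \<in> local_ring P"
    by (rule local_ringI[OF G(1) form_linear_form_power]) (simp add: eval_p)
  then have g: "g \<in> local_ring P"
    by (simp add: g_def to_fract_power)
  have I: "local_ideal F G P = {a * f + b * g | a b. a \<in> local_ring P \<and> b \<in> local_ring P}"
    unfolding f_def g_def by (rule local_ideal_eq[OF form_F F_nonzero G]) (simp add: eval_p)
  have I_add: "x + y \<in> local_ideal F G P" if xy: "x \<in> local_ideal F G P" "y \<in> local_ideal F G P" for x y
  proof -
    obtain a b where ab: "x = a * f + b * g" "a \<in> local_ring P" "b \<in> local_ring P"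
      using xy(1) unfolding I by blast
    moreover obtain a' b' where "y = a' * f + b' * g" "a' \<in> local_ring P" "b' \<in> local_ring P"
      using xy(2) unfolding I by blast
    ultimately have "x + y = (a + a') * f + (b + b') * g" "a + a' \<in> local_ring P" "b + b' \<in> local_ring P"
      by (simp_all add: algebra_simps local_ring_add)
    then show ?thesis unfolding I by blast
  qed
  have I_mult: "h * x \<in> local_ideal F G P" if hx: "h \<in> local_ring P" "x \<in> local_ideal F G P" for h x
  proof -
    obtain a b where ab: "x = a * f + b * g" "a \<in> local_ring P" "b \<in> local_ring P"
      using hx(2) unfolding I by blast
    then have "h * x = (h * a) * f + (h * b) * g" "h * a \<in> local_ring P" "h * b \<in> local_ring P"
      using hx(1) by (simp_all add: algebra_simps local_ring_mult)
    then show ?thesis unfolding I by blast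
  qed
  have f_in: "f * b \<in> local_ideal F G P" if "b \<in> local_ring P" for b
    using that local_ring_0 unfolding I by (force simp: mult.commute)
  from order_at_least_or_exactly[OF g, of k] show ?thesis
  proof (elim disjE exE conjE bexE)
    fix a b assume ab: "a \<in> local_ring P" "b \<in> local_ring P" "g = u ^ k * a + f * b"
    obtain A1 C1 where a: "eval3 C1 p \<noteq> 0" "C1 \<noteq> 0" "a = to_fract A1 / to_fract C1"
      using ab(1) by (rule local_ringE)
    obtain A2 C2 where b: "eval3 C2 p \<noteq> 0" "C2 \<noteq> 0" "b = to_fract A2 / to_fract C2"
      using ab(2) by (rule local_ringE)
    have "to_fract (C1 * C2 * N ^ k * N ^ Suc d * G) =
        to_fract (L ^ k * (A1 * C2 * N ^ Suc d * N ^ e) + F * (A2 * C1 * N ^ k * N ^ e))"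
      using ab(3) a b N_nonzero
      by (simp add: g_def f_def u_def to_fract_power power_divide field_simps)
    then have "C1 * C2 * N ^ k * N ^ Suc d * G =
        L ^ k * (A1 * C2 * N ^ Suc d * N ^ e) + F * (A2 * C1 * N ^ k * N ^ e)"
      by (simp only: to_fract_eq_iff)
    then show ?thesis
      by (rule contact_idealI[rotated]) (use a b eval_p in simp)
  next
    fix j a b assume j: "j < k" "a \<in> local_ring P" "b \<in> local_ring P" "u ^ j = g * a + f * b"
    then have u_j: "u ^ j \<in> local_ideal F G P"
      unfolding I by (auto simp: algebra_simps)
    have "intersection_mult F G P \<le> enat j"
    proof (rule intersection_mult_le[where e = "\<lambda>i. u ^ i"])
      show "0 \<in> local_ideal F G P"
        using f_in[OF local_ring_0] by simp
      show "\<exists>c. h - (\<Sum>i<j. to_fract (const3 (c i)) * u ^ i) \<in> local_ideal F G P"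
        if h: "h \<in> local_ring P" for h
      proof -
        obtain c a b where "a \<in> local_ring P" "b \<in> local_ring P"
          "h = (\<Sum>i<j. to_fract (const3 (c i)) * u ^ i) + u ^ j * a + f * b"
          using adic_expansion[OF h] by blast
        then have "h - (\<Sum>i<j. to_fract (const3 (c i)) * u ^ i) = a * u ^ j + f * b"
          "a * u ^ j + f * b \<in> local_ideal F G P"
          using I_add I_mult f_in u_j by simp_all
        then show ?thesis by metis
      qed
    qed (use I_add I_mult local_ring_const in blast)+
    with mult j(1) show ?thesis
      by (meson enat_ord_simps(1) leD order_trans)
  qed
qed

end

text \<open>Splitting \<open>C\<close> along \<open>l\<close> and \<open>t\<close>, the product rule gives the gradient at the point as
  \<open>A(P) l + Q(P) t\<close>. With \<open>t\<close> equal to that gradient, the coefficients must be \<open>0\<close> and \<open>1\<close>. An arbitrary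
  frame is needed first to see that the gradient vanishes on the point.\<close>

lemma tangent_frame:
  assumes C: "form (Suc d) C" "eval3 C (hcoords P) = 0" and t: "t = gradient C (hcoords P)" "t \<noteq> 0"
  obtains n l r q A Q where "frame n l t (hcoords P) r q" "form d A" "form d Q"
    "C = linear_form l * A + linear_form t * Q" "eval3 A (hcoords P) = 0" "eval3 Q (hcoords P) = 1"
proof -
  define p where "p = hcoords P"
  have split_at_p: "\<exists>A Q. form d A \<and> form d Q \<and> C = linear_form l' * A + linear_form t' * Q \<and>
      t = eval3 A p *s l' + eval3 Q p *s t'"
    if fr: "frame n' l' t' p r' q'" for n' l' t' r' q'
  proof -
    obtain A Q where "form d A" "form d Q" "C = linear_form l' * A + linear_form t' * Q"
      using form_vanishing_split[OF fr C(1)] C(2) by (auto simp: p_def)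
    moreover from this have "t = eval3 A p *s l' + eval3 Q p *s t'"
      using fr by (simp add: t(1) p_def[symmetric] gradient_mult frame_def)
    ultimately show ?thesis by blast
  qed
  obtain n l' t' r' q' where fr': "frame n l' t' p r' q'"
    using frame_exists hcoords_nonzero p_def by metis
  then have "pairing t p = 0"
    using split_at_p[OF fr'] by (auto simp: frame_def)
  then obtain l r q where fr: "frame n l t p r q"
    using frame_with_last_covector[OF fr' t(2)] by metis
  obtain A Q where AQ: "form d A" "form d Q" "C = linear_form l * A + linear_form t * Q"
    "t = eval3 A p *s l + eval3 Q p *s t"
    using split_at_p[OF fr] by blast
  have "eval3 A p = 0" "eval3 Q p = 1"
    using arg_cong[OF AQ(4), of "\<lambda>w. pairing w r"] arg_cong[OF AQ(4), of "\<lambda>w. pairing w q"] fr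
    by (simp_all add: frame_def)
  then show thesis
    using that fr AQ(1-3) unfolding p_def by blast
qed

section \<open>Conics in high contact with a cubic\<close>

lemma form_1_expand:
  assumes fr: "frame n l t p r q" and A: "form 1 A"
  obtains a b c where
    "A = linear_form n * const3 a + linear_form l * const3 b + linear_form t * const3 c"
proof -
  obtain A0 A1 A2 where A012: "form 0 A0" "form 0 A1" "form 0 A2"
    "A = linear_form n * A0 + linear_form l * A1 + linear_form t * A2"
    using form_Suc_split[OF fr A[unfolded One_nat_def]] .
  then obtain a b c where "A0 = const3 a" "A1 = const3 b" "A2 = const3 c"
    by (metis form_0D)
  with A012(4) show thesis
    by (simp add: that)
qed

lemma form_2_expand:
  assumes fr: "frame n l t p r q" and D: "form 2 D"
  obtains d0 d1 d2 d3 d4 d5 where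
    "D = const3 d0 * linear_form n ^ 2 + const3 d1 * (linear_form n * linear_form l) +
      const3 d2 * (linear_form n * linear_form t) + const3 d3 * linear_form l ^ 2 +
      const3 d4 * (linear_form l * linear_form t) + const3 d5 * linear_form t ^ 2"
proof -
  obtain A0 A1 A2 where A: "form 1 A0" "form 1 A1" "form 1 A2"
    "D = linear_form n * A0 + linear_form l * A1 + linear_form t * A2"
    using form_Suc_split[OF fr, of 1 D] D by (metis Suc_1)
  obtain a0 b0 c0 a1 b1 c1 a2 b2 c2 where
    "A0 = linear_form n * const3 a0 + linear_form l * const3 b0 + linear_form t * const3 c0"
    "A1 = linear_form n * const3 a1 + linear_form l * const3 b1 + linear_form t * const3 c1"
    "A2 = linear_form n * const3 a2 + linear_form l * const3 b2 + linear_form t * const3 c2"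
    using form_1_expand[OF fr A(1)] form_1_expand[OF fr A(2)] form_1_expand[OF fr A(3)] by metis
  then have "D = const3 a0 * linear_form n ^ 2 + const3 (b0 + a1) * (linear_form n * linear_form l) +
      const3 (c0 + a2) * (linear_form n * linear_form t) + const3 b1 * linear_form l ^ 2 +
      const3 (c1 + b2) * (linear_form l * linear_form t) + const3 c2 * linear_form t ^ 2"
    by (simp add: A(4) const3_add power2_eq_square algebra_simps)
  then show thesis
    by (rule that)
qed

context smooth_point
begin

abbreviation "J \<equiv> contact_ideal F l p"

lemma cancel_L: "L * G \<in> J (Suc k) \<Longrightarrow> G \<in> J k"
  using contact_ideal_cancel l_nonzero not_L_dvd_F by blast

text \<open>The tangent vanishes to one order more than the factor \<open>A\<close> of \<open>F = LA + TQ\<close>, as \<open>Q\<close> is a unit.\<close>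

lemma tangent_contact:
  assumes "A = L ^ i * B"
  shows "T \<in> J (Suc i)"
proof (rule contact_ideal_saturated[OF Q_nonzero])
  have "Q * T = F * 1 + L ^ Suc i * - B"
    by (simp add: F_eq assms algebra_simps)
  then show "Q * T \<in> J (Suc i)"
    by (metis contact_ideal_add contact_ideal_curve contact_ideal_power order_refl)
qed

text \<open>\<open>N\<^sup>2\<close> and \<open>NL\<close> have orders \<open>0\<close> and \<open>1\<close>, so neither can occur in an element of order \<open>2\<close>.\<close>

lemma leading_coefficients_vanish:
  assumes G: "const3 a * N ^ 2 + const3 b * (N * L) + H \<in> J 2" and H: "H \<in> J 2"
  shows "a = 0" "b = 0"
proof -
  have J2: "const3 a * N ^ 2 + const3 b * (N * L) \<in> J (Suc (Suc 0))"
    using contact_ideal_diff[OF G H] by (simp add: numeral_2_eq_2)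
  show "a = 0"
    using contact_ideal_vanish[OF J2] eval_p by simp
  with J2 have "L * (const3 b * N) \<in> J (Suc (Suc 0))"
    by (simp add: mult_ac)
  then have "const3 b * N \<in> J (Suc 0)"
    by (rule cancel_L)
  from contact_ideal_vanish[OF this] show "b = 0"
    using eval_p by simp
qed

end

text \<open>Along \<open>C = L\<^sup>3B + TQ\<close> the tangent has order at least \<open>3\<close>, so among the monomials not divisible by \<open>T\<close>
  the orders \<open>0, 1, 2\<close> of \<open>N\<^sup>2, NL, L\<^sup>2\<close> are all below \<open>3\<close> and distinct: they cannot occur in \<open>D\<close>. That the
  cofactor vanishes at the origin records that it is not a unit.\<close>

lemma flex_tangent_dvd_conic:
  assumes "smooth_point S n l t r q 2 C (linear_form l ^ 2 * B) Q"
    and D: "form 2 D" "D \<in> contact_ideal C l (hcoords S) 3"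
  shows "\<exists>E. eval3 E 0 = 0 \<and> D = linear_form t * E"
proof -
  interpret smooth_point S n l t r q 2 C "linear_form l ^ 2 * B" Q
    by fact
  have T3: "T \<in> J 3"
    using tangent_contact[of 2 B] by (simp add: numeral_3_eq_3 numeral_2_eq_2)
  obtain d0 d1 d2 d3 d4 d5 where D_eq: "D = const3 d0 * N ^ 2 + const3 d1 * (N * L) +
      const3 d2 * (N * T) + const3 d3 * L ^ 2 + const3 d4 * (L * T) + const3 d5 * T ^ 2"
    using form_2_expand[OF frame D(1)] .
  define E where "E = const3 d2 * N + const3 d4 * L + const3 d5 * T"
  have D_eq': "D = const3 d0 * N ^ 2 + const3 d1 * (N * L) + (L ^ 2 * const3 d3 + E * T)"
    by (simp add: D_eq E_def algebra_simps power2_eq_square)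
  have "L ^ 2 * const3 d3 + E * T \<in> J 2"
    using contact_ideal_mono[OF T3, of 2]
    by (intro contact_ideal_add contact_ideal_mult contact_ideal_power) simp_all
  moreover have "D \<in> J 2"
    by (rule contact_ideal_mono[OF D(2)]) simp
  ultimately have d01: "d0 = 0" "d1 = 0"
    using leading_coefficients_vanish[of d0 d1] unfolding D_eq' by blast+
  have "D - E * T \<in> J (Suc (Suc (Suc 0)))"
    using contact_ideal_diff[OF D(2) contact_ideal_mult[OF T3]] unfolding numeral_3_eq_3 .
  also have "D - E * T = L * (L * const3 d3)"
    by (simp add: D_eq' d01 power2_eq_square mult.assoc)
  finally have "const3 d3 \<in> J (Suc 0)"
    by (rule cancel_L[OF cancel_L])
  from contact_ideal_vanish[OF this] have "d3 = 0"
    using eval_p by simp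
  then have "D = T * E"
    by (simp add: D_eq' d01 mult.commute)
  moreover have "eval3 E 0 = 0"
    by (simp add: E_def)
  ultimately show ?thesis by blast
qed

text \<open>Along \<open>C\<close> the form \<open>T\<close> has order \<open>2\<close>. Write \<open>D = d2 NT + d3 L\<^sup>2 + d4 LT + d5 T\<^sup>2\<close>; the first two
  coefficients vanish. Multiplying by \<open>\<kappa>N\<close> and replacing \<open>\<kappa>L\<^sup>2N\<close> by \<open>-TQ\<close> makes the result divisible by
  \<open>T\<close>; the quotient \<open>E\<close> is a quadratic form of order at least \<open>4\<close>. Its first two coefficients
  vanish in turn, and the same step leads to a quadratic form \<open>E'\<close> of order at least \<open>2\<close>, whose
  \<open>NL\<close>-coefficient is \<open>d3 (q1 q3 - \<kappa> q4)\<close>. If \<open>d3 = 0\<close>, then \<open>T\<close> divides \<open>D\<close>.\<close>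

lemma conic_contact_6:
  assumes "smooth_point S n l t r q 2 C (linear_form l * (const3 \<kappa> * linear_form n)) Q"
    and \<kappa>: "\<kappa> \<noteq> 0"
    and Q_eq: "Q = const3 q0 * linear_form n ^ 2 + const3 q1 * (linear_form n * linear_form l) +
      const3 q2 * (linear_form n * linear_form t) + const3 q3 * linear_form l ^ 2 +
      const3 q4 * (linear_form l * linear_form t) + const3 q5 * linear_form t ^ 2"
    and D: "form 2 D" "D \<in> contact_ideal C l (hcoords S) 6"
  shows "(\<exists>E. eval3 E 0 = 0 \<and> D = linear_form t * E) \<or> q1 * q3 = \<kappa> * q4"
proof -
  interpret smooth_point S n l t r q 2 C "linear_form l * (const3 \<kappa> * linear_form n)" Q
    by fact
  define k where "k = const3 \<kappa>"
  have F: "C = k * L ^ 2 * N + T * Q"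
    by (simp add: F_eq k_def power2_eq_square)
  have T2: "G * T \<in> J 2" for G
    using tangent_contact[of 1 "k * N"] contact_ideal_mult by (simp add: k_def numeral_2_eq_2)
  have cancel_T: "E \<in> J j" if E: "T * E \<in> J (Suc (Suc j))" for E j
  proof -
    have "L * (L * ((k * N) * E)) = C * E - Q * (T * E)"
      by (simp add: F power2_eq_square algebra_simps)
    also have "\<dots> \<in> J (Suc (Suc j))"
      by (intro contact_ideal_diff contact_ideal_curve contact_ideal_mult E)
    finally have "(k * N) * E \<in> J j"
      by (rule cancel_L[OF cancel_L])
    then show ?thesis
      by (rule contact_ideal_saturated[rotated]) (simp add: k_def \<kappa> eval_p)
  qed
  obtain d0 d1 d2 d3 d4 d5 where D_eq: "D = const3 d0 * N ^ 2 + const3 d1 * (N * L) +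
      const3 d2 * (N * T) + const3 d3 * L ^ 2 + const3 d4 * (L * T) + const3 d5 * T ^ 2"
    using form_2_expand[OF frame D(1)] .
  have "const3 d0 * N ^ 2 + const3 d1 * (N * L) +
      (L ^ 2 * const3 d3 + (const3 d2 * N + const3 d4 * L + const3 d5 * T) * T) \<in> J 2"
    using contact_ideal_mono[OF D(2), of 2] by (simp add: D_eq algebra_simps power2_eq_square)
  moreover have "L ^ 2 * const3 d3 + (const3 d2 * N + const3 d4 * L + const3 d5 * T) * T \<in> J 2"
    by (intro contact_ideal_add contact_ideal_power T2) simp
  ultimately have "d0 = 0" "d1 = 0"
    by (rule leading_coefficients_vanish)+
  then have D_eq': "D = const3 d2 * (N * T) + const3 d3 * L ^ 2 + const3 d4 * (L * T) + const3 d5 * T ^ 2"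
    by (simp add: D_eq)
  show ?thesis
  proof (cases "d3 = 0")
    case True
    then have "D = T * (const3 d2 * N + const3 d4 * L + const3 d5 * T)"
      by (simp add: D_eq' algebra_simps power2_eq_square)
    moreover have "eval3 (const3 d2 * N + const3 d4 * L + const3 d5 * T) 0 = 0"
      by simp
    ultimately show ?thesis by blast
  next
    case False
    define E where "E = const3 (\<kappa> * d2) * N ^ 2 - const3 d3 * Q + const3 (\<kappa> * d4) * (L * N) +
      const3 (\<kappa> * d5) * (T * N)"
    have "T * E = (k * N) * D - C * const3 d3"
      by (simp add: D_eq' E_def F k_def const3_mult power2_eq_square algebra_simps)
    also have "\<dots> \<in> J 6"
      by (intro contact_ideal_diff contact_ideal_curve contact_ideal_mult D)
    finally have "T * E \<in> J (Suc (Suc 4))"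
      by simp
    then have E4: "E \<in> J 4"
      by (rule cancel_T)
    have E_eq: "E = const3 (\<kappa> * d2 - d3 * q0) * N ^ 2 + const3 (\<kappa> * d4 - d3 * q1) * (N * L) +
        (L ^ 2 * const3 (- d3 * q3) +
         (const3 (\<kappa> * d5 - d3 * q2) * N - const3 (d3 * q4) * L - const3 (d3 * q5) * T) * T)"
      by (simp add: E_def Q_eq const3_mult const3_diff const3_uminus power2_eq_square algebra_simps)
    have "L ^ 2 * const3 (- d3 * q3) +
         (const3 (\<kappa> * d5 - d3 * q2) * N - const3 (d3 * q4) * L - const3 (d3 * q5) * T) * T \<in> J 2"
      by (intro contact_ideal_add contact_ideal_power T2) simp
    moreover have "E \<in> J 2"
      by (rule contact_ideal_mono[OF E4]) simp
    ultimately have "\<kappa> * d2 - d3 * q0 = 0" "\<kappa> * d4 - d3 * q1 = 0"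
      using leading_coefficients_vanish[of "\<kappa> * d2 - d3 * q0" "\<kappa> * d4 - d3 * q1"]
      unfolding E_eq by blast+
    then have E_eq': "E = L ^ 2 * const3 (- d3 * q3) +
        (const3 (\<kappa> * d5 - d3 * q2) * N - const3 (d3 * q4) * L - const3 (d3 * q5) * T) * T"
      by (simp add: E_eq)
    define E' where "E' = const3 (\<kappa> * (\<kappa> * d5 - d3 * q2)) * N ^ 2 - const3 (\<kappa> * d3 * q4) * (N * L) -
      const3 (\<kappa> * d3 * q5) * (T * N) + const3 (d3 * q3) * Q"
    have "T * E' = (k * N) * E + C * const3 (d3 * q3)"
      by (simp add: E_eq' E'_def F k_def const3_mult const3_diff const3_uminus power2_eq_square algebra_simps)
    also have "\<dots> \<in> J 4"
      by (intro contact_ideal_add contact_ideal_curve contact_ideal_mult E4)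
    finally have "T * E' \<in> J (Suc (Suc 2))"
      by simp
    then have E'2: "E' \<in> J 2"
      by (rule cancel_T)
    have E'_eq: "E' = const3 (\<kappa> * (\<kappa> * d5 - d3 * q2) + d3 * q3 * q0) * N ^ 2 +
        const3 (d3 * (q1 * q3 - \<kappa> * q4)) * (N * L) +
        (L ^ 2 * const3 (d3 * q3 * q3) +
         (const3 (d3 * q3 * q2 - \<kappa> * d3 * q5) * N + const3 (d3 * q3 * q4) * L + const3 (d3 * q3 * q5) * T) * T)"
      by (simp add: E'_def Q_eq const3_add const3_mult const3_diff power2_eq_square algebra_simps)
    have "L ^ 2 * const3 (d3 * q3 * q3) +
         (const3 (d3 * q3 * q2 - \<kappa> * d3 * q5) * N + const3 (d3 * q3 * q4) * L + const3 (d3 * q3 * q5) * T) * T \<in> J 2"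
      by (intro contact_ideal_add contact_ideal_power T2) simp
    with E'2 have "d3 * (q1 * q3 - \<kappa> * q4) = 0"
      unfolding E'_eq by (rule leading_coefficients_vanish)
    with False show ?thesis
      by simp
  qed
qed

section \<open>The residual point\<close>

text \<open>At the point \<open>r\<close>, where \<open>N = T = 0\<close>, the tangent is \<open>\<kappa>N + q3 T\<close> up to a constant. Eliminating \<open>N\<close> by
  \<open>\<kappa>N = -q3 T\<close> turns \<open>\<kappa>\<^sup>2C\<close> into \<open>\<mu>T\<^sup>3 + \<kappa>(\<kappa> q4 - q1 q3) LT\<^sup>2\<close>, so the hypothesis on \<open>q4\<close> leaves a cube.\<close>

lemma flex_of_normal_form:
  assumes C: "smooth_plane_curve 3 C" and fr: "frame n l t p r q"
    and C_eq: "C = const3 \<kappa> * (linear_form l ^ 2 * linear_form n) + linear_form t * Q" and \<kappa>: "\<kappa> \<noteq> 0"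
    and Q_eq: "Q = const3 q0 * linear_form n ^ 2 + const3 q1 * (linear_form n * linear_form l) +
      const3 q2 * (linear_form n * linear_form t) + const3 q3 * linear_form l ^ 2 +
      const3 q4 * (linear_form l * linear_form t) + const3 q5 * linear_form t ^ 2"
    and q4: "q1 * q3 = \<kappa> * q4"
    and R: "hcoords R = c *s r"
  shows "flex C R"
proof -
  define N where "N = linear_form n"
  define L where "L = linear_form l"
  define T where "T = linear_form t"
  define \<mu> where "\<mu> = q0 * q3 ^ 2 - \<kappa> * q2 * q3 + \<kappa> ^ 2 * q5"
  define G where "G = const3 (\<kappa> ^ 2) * L ^ 2 +
    T * (const3 q0 * (const3 \<kappa> * N - const3 q3 * T) + const3 (\<kappa> * q1) * L + const3 (\<kappa> * q2) * T)"
  have c: "c \<noteq> 0"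
    using R hcoords_nonzero[of R] by auto
  have "gradient C (hcoords R) = c\<^sup>2 *s (\<kappa> *s n + q3 *s t)"
    using fr by (simp add: R C_eq Q_eq gradient_mult frame_def vec_eq_iff power2_eq_square algebra_simps)
  then have tangent: "tangent_line C R = const3 (c\<^sup>2) * (const3 \<kappa> * N + const3 q3 * T)"
    by (simp add: tangent_line_eq_linear_form linear_form_scale linear_form_add N_def T_def
        const3_mult algebra_simps)
  have kq4: "const3 \<kappa> * const3 q4 = const3 q1 * const3 q3"
    by (simp add: q4 flip: const3_mult)
  have "const3 (\<kappa> ^ 2) * C = T ^ 3 * const3 \<mu> + (const3 \<kappa> * N + const3 q3 * T) * G +
      const3 \<kappa> * (const3 \<kappa> * const3 q4 - const3 q1 * const3 q3) * (L * T ^ 2)"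
    by (simp add: C_eq Q_eq \<mu>_def G_def const3_add const3_diff const3_mult
        power2_eq_square power3_eq_cube algebra_simps flip: N_def L_def T_def)
  then have identity: "const3 (\<kappa> ^ 2) * C = T ^ 3 * const3 \<mu> + (const3 \<kappa> * N + const3 q3 * T) * G"
    by (simp add: kq4)
  have inv: "const3 (1 / \<kappa> ^ 2) * const3 (\<kappa> ^ 2) = 1"
    "const3 (c\<^sup>2) * const3 (1 / (\<kappa>\<^sup>2 * c\<^sup>2)) = const3 (1 / \<kappa> ^ 2)"
    "const3 (1 / \<kappa> ^ 2) * const3 \<mu> = const3 (\<mu> / \<kappa> ^ 2)"
    using \<kappa> c by (simp_all flip: const3_mult)
  have "C = const3 (1 / \<kappa> ^ 2) * (const3 (\<kappa> ^ 2) * C)"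
    by (simp add: inv flip: mult.assoc)
  also have "\<dots> = T ^ 3 * (const3 (1 / \<kappa> ^ 2) * const3 \<mu>) +
      (const3 \<kappa> * N + const3 q3 * T) * (const3 (c\<^sup>2) * const3 (1 / (\<kappa>\<^sup>2 * c\<^sup>2))) * G"
    unfolding identity inv(2) by (simp add: algebra_simps)
  also have "\<dots> = T ^ 3 * const3 (\<mu> / \<kappa> ^ 2) + tangent_line C R * (const3 (1 / (\<kappa>\<^sup>2 * c\<^sup>2)) * G)"
    unfolding inv(3) tangent by (simp add: mult_ac)
  finally have C_cube: "C = T ^ 3 * const3 (\<mu> / \<kappa> ^ 2) +
      tangent_line C R * (const3 (1 / (\<kappa>\<^sup>2 * c\<^sup>2)) * G)" .
  have at_p: "eval3 (tangent_line C R) p = c\<^sup>2 * \<kappa>"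
    using fr by (simp add: tangent N_def T_def frame_def)
  \<comment> \<open>The two lines differ: at \<open>p\<close> only \<open>T\<close> vanishes.\<close>
  have not_dvd: "\<not> T dvd tangent_line C R"
  proof
    assume "T dvd tangent_line C R"
    then obtain H where "tangent_line C R = T * H" ..
    then have "c\<^sup>2 * \<kappa> = 0"
      using at_p fr by (simp add: T_def frame_def)
    then show False
      using c \<kappa> by simp
  qed
  have "enat 3 \<le> intersection_mult C (tangent_line C R) R"
  proof (rule intersection_mult_ge)
    show "form 3 C" "C \<noteq> 0"
      using C by (simp_all add: smooth_plane_curve_def)
    show "form 1 (tangent_line C R)"
      unfolding tangent_line_eq_linear_form by (rule form_linear_form)
    show "tangent_line C R \<noteq> 0"
      using not_dvd by auto
    show "eval3 (tangent_line C R) (hcoords R) = 0" "pairing t (hcoords R) = 0"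
      "pairing l (hcoords R) \<noteq> 0" "t \<noteq> 0"
      using fr c by (auto simp: tangent R N_def T_def frame_def)
    show "\<not> linear_form t dvd tangent_line C R"
      using not_dvd by (simp add: T_def)
    show "C = linear_form t ^ 3 * const3 (\<mu> / \<kappa> ^ 2) +
        tangent_line C R * (const3 (1 / (\<kappa>\<^sup>2 * c\<^sup>2)) * G)"
      using C_cube by (simp add: T_def)
  qed
  moreover have "(2 :: enat) < enat 3"
    by (simp add: numeral_eq_enat)
  ultimately have "intersection_mult C (tangent_line C R) R > 2"
    by (rule less_le_trans[rotated])
  moreover have "on_curve C R"
    using fr by (simp add: on_curve_def R C_eq frame_def)
  ultimately show ?thesis
    using C unfolding flex_def by blast
qed

text \<open>On the line \<open>t = 0\<close> the cubic restricts to \<open>\<kappa>l\<^sup>2n\<close>, whose zeros are the point \<open>P\<close> (where \<open>l = 0\<close>) and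
  the point \<open>r\<close> (where \<open>n = 0\<close>).\<close>

lemma residual_point_eqI:
  assumes fr: "frame n l t (hcoords P) r q" and t: "t = gradient C (hcoords P)"
    and C_eq: "C = const3 \<kappa> * (linear_form l ^ 2 * linear_form n) + linear_form t * Q" and \<kappa>: "\<kappa> \<noteq> 0"
    and R: "hcoords R = c *s r"
  shows "residual_point C P = R"
  unfolding residual_point_def
proof (rule the_equality)
  have tangent: "on_curve (tangent_line C P) X \<longleftrightarrow> pairing t (hcoords X) = 0" for X
    by (simp add: tangent_line_eq_linear_form on_curve_def t)
  have "R \<noteq> P"
  proof
    assume "R = P"
    then have "pairing n (hcoords P) = c * pairing n r"
      using R by simp
    then show False
      using fr by (auto simp: frame_def)
  qed
  moreover have "on_curve C R"
    using fr by (simp add: on_curve_def R C_eq frame_def)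
  moreover have "on_curve (tangent_line C P) R"
    using fr by (simp add: tangent R frame_def)
  ultimately show "R \<noteq> P \<and> on_curve C R \<and> on_curve (tangent_line C P) R"
    by blast
  fix X assume X: "X \<noteq> P \<and> on_curve C X \<and> on_curve (tangent_line C P) X"
  define v where "v = hcoords X"
  have "pairing t v = 0" "eval3 C v = 0"
    using X tangent[of X] by (auto simp: on_curve_def v_def)
  then have zero: "pairing t v = 0" "pairing l v = 0 \<or> pairing n v = 0"
    using \<kappa> by (auto simp: C_eq)
  have v: "v = pairing n v *s hcoords P + pairing l v *s r"
    using frame_expand(2)[OF fr, of v] zero(1) by simp
  have "pairing l v \<noteq> 0"
  proof
    assume "pairing l v = 0"
    then have "hcoords X = pairing n v *s hcoords P"
      using v by (simp add: v_def)
    then show False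
      using proj_plane_eqI X by blast
  qed
  with zero v have "v = pairing l v *s r"
    by simp
  moreover have "c \<noteq> 0"
    using R hcoords_nonzero[of R] by auto
  ultimately have "hcoords X = (pairing l v / c) *s hcoords R"
    by (simp add: v_def[symmetric] R vec_eq_iff)
  then show "X = R"
    using proj_plane_eqI by blast
qed

text \<open>In \<open>C = LA + TQ\<close> the conic \<open>A\<close> vanishes at \<open>P\<close>, so it splits along \<open>L\<close> and \<open>T\<close> once more. The
  terms divisible by \<open>T\<close> go into the new \<open>Q\<close> and do not change its value at \<open>P\<close>.\<close>

lemma cubic_tangent_normal_form:
  assumes C: "smooth_plane_curve 3 C" "on_curve C P"
  obtains n l t r q \<alpha> \<beta> Q where "frame n l t (hcoords P) r q" "t = gradient C (hcoords P)" "form 2 Q"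
    "C = linear_form l ^ 2 * (const3 \<alpha> * linear_form n + const3 \<beta> * linear_form l) + linear_form t * Q"
    "eval3 Q (hcoords P) = 1"
proof -
  define t where "t = gradient C (hcoords P)"
  have "t \<noteq> 0"
    using C by (auto simp: smooth_plane_curve_def on_curve_def t_def gradient_def vec_eq_iff forall_3)
  moreover have "form (Suc 2) C" "eval3 C (hcoords P) = 0"
    using C by (simp_all add: smooth_plane_curve_def on_curve_def)
  ultimately obtain n l r q A Q where fr: "frame n l t (hcoords P) r q" and AQ: "form 2 A" "form 2 Q"
    "C = linear_form l * A + linear_form t * Q" "eval3 A (hcoords P) = 0" "eval3 Q (hcoords P) = 1"
    using tangent_frame[of 2 C P t] t_def by metis
  have "form (Suc 1) A"
    using AQ(1) by (simp add: numeral_2_eq_2)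
  then obtain B1 B2 where B: "form 1 B1" "form 1 B2" "A = linear_form l * B1 + linear_form t * B2"
    using form_vanishing_split[OF fr _ AQ(4)] by blast
  obtain \<alpha> \<beta> \<gamma> where B1: "B1 = linear_form n * const3 \<alpha> + linear_form l * const3 \<beta> + linear_form t * const3 \<gamma>"
    using form_1_expand[OF fr B(1)] .
  define Q' where "Q' = Q + linear_form l * B2 + const3 \<gamma> * linear_form l ^ 2"
  have "form 2 (linear_form l * B2)"
    using form_mult[OF form_linear_form B(2)] by (simp add: numeral_2_eq_2)
  then have "form 2 Q'"
    unfolding Q'_def by (intro form_add form_scale form_linear_form_power AQ)
  moreover have "C = linear_form l ^ 2 * (const3 \<alpha> * linear_form n + const3 \<beta> * linear_form l) + linear_form t * Q'"
    by (simp add: AQ(3) B(3) B1 Q'_def power2_eq_square algebra_simps)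
  moreover have "eval3 Q' (hcoords P) = 1"
    using fr AQ(5) by (simp add: Q'_def frame_def)
  ultimately show thesis
    using that fr t_def by blast
qed

text \<open>Irreducibility of the conic is used twice: it excludes that \<open>S\<close> is a flex (\<open>\<alpha> = 0\<close>), and it excludes
  the degenerate alternative in the analysis of the contact of order \<open>6\<close>.\<close>

lemma residual_point_of_sextactic_is_flex:
  assumes C: "smooth_plane_curve 3 C" and S: "sextactic C S"
  shows "flex C (residual_point C S)"
proof -
  obtain D where D: "form 2 D" "irreducible D" "enat 6 \<le> intersection_mult C D S" and on: "on_curve C S"
    using S by (auto simp: sextactic_def numeral_eq_enat)
  then have "D \<noteq> 0"
    by (auto simp: irreducible_def)
  obtain n l t r q \<alpha> \<beta> Q where fr: "frame n l t (hcoords S) r q" and t: "t = gradient C (hcoords S)"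
    and Q: "form 2 Q" "eval3 Q (hcoords S) = 1"
    and C_eq: "C = linear_form l ^ 2 * (const3 \<alpha> * linear_form n + const3 \<beta> * linear_form l) + linear_form t * Q"
    using cubic_tangent_normal_form[OF C on] by metis
  have not_dvd: "\<not> (\<exists>E. eval3 E 0 = 0 \<and> D = linear_form t * E)"
  proof
    assume "\<exists>E. eval3 E 0 = 0 \<and> D = linear_form t * E"
    then obtain E where E: "eval3 E 0 = 0" "D = linear_form t * E"
      by blast
    have "\<not> is_unit G" if "eval3 G 0 = 0" for G
    proof
      assume "is_unit G"
      then obtain H where "1 = G * H" ..
      then have "eval3 1 0 = eval3 (G * H) 0"
        by (rule arg_cong)
      with that show False by simp
    qed
    then have "\<not> is_unit E" "\<not> is_unit (linear_form t)"
      using E(1) by simp_all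
    then show False
      using D(2) E(2) by (auto dest: irreducibleD)
  qed
  have contact: "D \<in> contact_ideal C l (hcoords S) 6"
    if "smooth_point S n' l t r' q 2 C A Q" for n' r' A
    using smooth_point.contact_of_intersection_mult[OF that D(1) \<open>D \<noteq> 0\<close> D(3)] .
  have "\<alpha> \<noteq> 0"
  proof
    assume "\<alpha> = 0"
    have sp: "smooth_point S n l t r q 2 C (linear_form l ^ 2 * const3 \<beta>) Q"
    proof
      show "form 2 (linear_form l ^ 2 * const3 \<beta>)"
        using form_mult[OF form_linear_form_power form_const3] by force
    qed (use fr Q C_eq \<open>\<alpha> = 0\<close> in \<open>simp_all add: power2_eq_square algebra_simps\<close>)
    have "D \<in> contact_ideal C l (hcoords S) 3"
      by (rule contact_ideal_mono[OF contact[OF sp]]) simp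
    then show False
      using flex_tangent_dvd_conic[OF sp D(1)] not_dvd by blast
  qed
  \<comment> \<open>The line \<open>\<alpha>n + \<beta>l\<close> passes through the residual point; dividing by \<open>\<alpha>\<close> keeps its value at \<open>S\<close>.\<close>
  define n' where "n' = n + (\<beta> / \<alpha>) *s l"
  define r' where "r' = r - (\<beta> / \<alpha>) *s hcoords S"
  have fr': "frame n' l t (hcoords S) r' q"
    unfolding n'_def r'_def by (rule frame_shear[OF fr])
  have "const3 \<alpha> * linear_form n' = linear_form (\<alpha> *s n')"
    by (simp add: linear_form_scale)
  also have "\<alpha> *s n' = \<alpha> *s n + \<beta> *s l"
    using \<open>\<alpha> \<noteq> 0\<close> by (simp add: n'_def vec_eq_iff algebra_simps)
  finally have "const3 \<alpha> * linear_form n' = const3 \<alpha> * linear_form n + const3 \<beta> * linear_form l"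
    by (simp add: linear_form_add linear_form_scale)
  then have C_eq': "C = const3 \<alpha> * (linear_form l ^ 2 * linear_form n') + linear_form t * Q"
    by (simp add: C_eq mult.left_commute)
  have sp: "smooth_point S n' l t r' q 2 C (linear_form l * (const3 \<alpha> * linear_form n')) Q"
  proof
    have "form (1 + 1) (linear_form l * (const3 \<alpha> * linear_form n'))"
      by (intro form_mult form_scale form_linear_form)
    then show "form 2 (linear_form l * (const3 \<alpha> * linear_form n'))"
      by (simp add: numeral_2_eq_2)
  qed (use fr' Q C_eq' in \<open>simp_all add: power2_eq_square algebra_simps\<close>)
  obtain q0 q1 q2 q3 q4 q5 where Q_eq: "Q = const3 q0 * linear_form n' ^ 2 + const3 q1 * (linear_form n' * linear_form l) +
      const3 q2 * (linear_form n' * linear_form t) + const3 q3 * linear_form l ^ 2 +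
      const3 q4 * (linear_form l * linear_form t) + const3 q5 * linear_form t ^ 2"
    using form_2_expand[OF fr' Q(1)] .
  have q4: "q1 * q3 = \<alpha> * q4"
    using conic_contact_6[OF sp \<open>\<alpha> \<noteq> 0\<close> Q_eq D(1) contact[OF sp]] not_dvd by blast
  have "r' \<noteq> 0"
    using fr' by (auto simp: frame_def)
  then obtain c where R: "hcoords (proj_point r') = c *s r'"
    by (rule hcoords_proj_point)
  have "residual_point C S = proj_point r'"
    by (rule residual_point_eqI[OF fr' t C_eq' \<open>\<alpha> \<noteq> 0\<close> R])
  moreover have "flex C (proj_point r')"
    by (rule flex_of_normal_form[OF C fr' C_eq' \<open>\<alpha> \<noteq> 0\<close> Q_eq q4 R])
  ultimately show ?thesis by simp
qed

lemma form_fermat_cubic: "form 3 fermat_cubic"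
  unfolding fermat_cubic_def
  using form_power[OF form_vars(1), of 3] form_power[OF form_vars(2), of 3] form_power[OF form_vars(3), of 3]
  by (intro form_add) simp_all

theorem theorem2:
  fixes S :: proj_plane
  assumes "sextactic fermat_cubic S"
  shows "flex fermat_cubic (residual_point fermat_cubic S)"
proof -
  obtain d where d: "smooth_plane_curve d fermat_cubic"
    using assms by (auto simp: sextactic_def)
  then have "d = 3"
    using form_degree_unique form_fermat_cubic by (auto simp: smooth_plane_curve_def)
  with d assms show ?thesis
    using residual_point_of_sextactic_is_flex by blast
qed

end
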